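(* Let $p$ be a prime number, let $\mathbb{Z}_p$ denote the ring of $p$-adic integers, $\mathbb{Q}_p$ the field of $p$-adic numbers equipped with a $p$-adic absolute value $|\cdot|$, and let $\chi \colon \mathbb{Z}_p \to \mathbb{Q}_p^{\times}$ be an injective $p$-adic character on $\mathbb{Z}_p$. Then for any $(n,m) \in \mathbb{N}^2$, any continuous map $f \colon \mathbb{Z}_p^n \to \mathbb{Q}_p^m$, and any real number $\epsilon > 0$, there exists a tuple $(d,A,\vec{b},C)$ consisting of a $d \in \mathbb{N}$, a matrix $A \in \mathrm{M}_{d,n}(\mathbb{Z}_p)$, a vector $\vec{b} \in \mathbb{Z}_p^d$, and a matrix $C \in \mathrm{M}_{m,d}(\mathbb{Q}_p)$ such that for every $\vec{x} \in \mathbb{Z}_p^n$, \[ \| f(\vec{x}) - C\,\chi(A\vec{x} + \vec{b}) \| < \epsilon, \] where $\|\cdot\|$ is the $\ell^{\infty}$-norm on $\mathbb{Q}_p^m$ (i.e. $\|(z_j)_{j}\| = \max_j |z_j|$).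
   Context: A $p$-adic character on a topological group $G$ is a continuous group homomorphism $G \to \mathbb{Q}_p^{\times}$; here $\mathbb{Z}_p$ is regarded as a topological group under addition with its $p$-adic topology. $\mathbb{N}$ denotes the set of non-negative integers. For a function $\chi \colon \mathbb{Z}_p \to \mathbb{Q}_p$ and a vector $\vec{z} = (z_i)_{i=0}^{d-1} \in \mathbb{Z}_p^d$, $\chi(\vec{z})$ denotes the vector $(\chi(z_i))_{i=0}^{d-1} \in \mathbb{Q}_p^d$ obtained by applying $\chi$ entrywise; $C\,\chi(A\vec{x}+\vec{b})$ is the product of the matrix $C$ with this column vector. The absolute value $|\cdot|$ on $\mathbb{Q}_p$ is any $p$-adic absolute value (no fixed normalisation). *)

theory Defs
  imports
    "HOL-Analysis.Analysis"
    "HOL-Algebra.Group"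
    "Jordan_Normal_Form.Matrix"
    "Berlekamp_Zassenhaus.Finite_Field"
begin

section \<open>The \<open>p\<close>-adic absolute value on the rationals\<close>

definition rat_padic_abs :: "nat \<Rightarrow> rat \<Rightarrow> real" where
  "rat_padic_abs p x =
     (if x = 0 then 0
      else real p powi (int (multiplicity (int p) (snd (quotient_of x)))
                      - int (multiplicity (int p) (fst (quotient_of x)))))"

definition padic_cauchy :: "nat \<Rightarrow> (nat \<Rightarrow> rat) \<Rightarrow> bool" where
  "padic_cauchy p X \<longleftrightarrow> (\<forall>e>0. \<exists>k. \<forall>m\<ge>k. \<forall>n\<ge>k. rat_padic_abs p (X m - X n) < e)"

definition padic_vanishes :: "nat \<Rightarrow> (nat \<Rightarrow> rat) \<Rightarrow> bool" where
  "padic_vanishes p X \<longleftrightarrow> (\<lambda>n. rat_padic_abs p (X n)) \<longlonglongrightarrow> 0"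

definition padic_rel :: "nat \<Rightarrow> (nat \<Rightarrow> rat) \<Rightarrow> (nat \<Rightarrow> rat) \<Rightarrow> bool" where
  "padic_rel p X Y \<longleftrightarrow>
     padic_cauchy p X \<and> padic_cauchy p Y \<and> padic_vanishes p (\<lambda>n. X n - Y n)"

context
  fixes p :: nat
  assumes p: "prime p"
begin

private abbreviation (input) v :: "rat \<Rightarrow> real" where "v \<equiv> rat_padic_abs p"

lemma rat_padic_abs_0 [simp]: "rat_padic_abs q 0 = 0"
  by (simp add: rat_padic_abs_def)

lemma rat_padic_abs_quot:
  assumes "a \<noteq> 0" "b \<noteq> 0"
  shows "v (of_int a / of_int b)
           = real p powi (int (multiplicity (int p) b) - int (multiplicity (int p) a))"
proof -
  obtain c d where cd: "quotient_of (of_int a / of_int b) = (c, d)" by fastforce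
  from quotient_of_int_div[OF cd \<open>b \<noteq> 0\<close>] obtain z
    where z: "z \<noteq> 0" "a = c * z" "b = d * z" by blast
  have pe: "prime_elem (int p)" using p by simp
  have "c \<noteq> 0" "d \<noteq> 0" using z assms by auto
  then show ?thesis
    using assms z cd
    by (simp add: rat_padic_abs_def prime_elem_multiplicity_mult_distrib[OF pe])
qed

lemma rat_cases_quot:
  fixes x :: rat
  obtains a b :: int where "b > 0" "x = of_int a / of_int b"
  by (metis quotient_of_denom_pos quotient_of_div surj_pair)

lemma rat_padic_abs_mult: "v (x * y) = v x * v y"
proof (cases "x = 0 \<or> y = 0")
  case False
  obtain a b where ab: "b > 0" "x = of_int a / of_int b" by (rule rat_cases_quot)
  obtain c d where cd: "d > 0" "y = of_int c / of_int d" by (rule rat_cases_quot)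
  have nz: "a \<noteq> 0" "c \<noteq> 0" "b \<noteq> 0" "d \<noteq> 0" using False ab cd by auto
  have pe: "prime_elem (int p)" using p by simp
  have pp: "real p \<noteq> 0" using p by auto
  have xy: "x * y = of_int (a * c) / of_int (b * d)" using ab cd by simp
  have "v (x * y) = real p powi (int (multiplicity (int p) (b * d))
                               - int (multiplicity (int p) (a * c)))"
    unfolding xy using nz by (intro rat_padic_abs_quot) auto
  also have "\<dots> = real p powi ((int (multiplicity (int p) b) - int (multiplicity (int p) a))
                             + (int (multiplicity (int p) d) - int (multiplicity (int p) c)))"
    using nz by (simp add: prime_elem_multiplicity_mult_distrib[OF pe] algebra_simps)
  also have "\<dots> = v x * v y"
    using nz pp by (simp add: power_int_add rat_padic_abs_quot ab(2) cd(2))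
  finally show ?thesis .
qed (auto simp: rat_padic_abs_def)

lemma rat_padic_abs_nonneg [simp]: "v x \<ge> 0"
  by (simp add: rat_padic_abs_def)

lemma rat_padic_abs_eq_0 [simp]: "v x = 0 \<longleftrightarrow> x = 0"
  using p by (auto simp: rat_padic_abs_def)

lemma rat_padic_abs_1 [simp]: "v 1 = 1"
  using rat_padic_abs_quot[of 1 1] by simp

lemma rat_padic_abs_minus [simp]: "v (- x) = v x"
proof -
  have "v (-1) * v (-1) = 1"
    by (metis rat_padic_abs_mult rat_padic_abs_1 minus_mult_minus mult_1)
  then have "v (-1) = 1"
    using rat_padic_abs_nonneg[of "-1"]
    by (metis abs_of_nonneg abs_square_eq_1 power2_eq_square)
  then show ?thesis using rat_padic_abs_mult[of "-1" x] by simp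
qed

lemma rat_padic_abs_minus_commute: "v (x - y) = v (y - x)"
  using rat_padic_abs_minus[of "x - y"] by simp

lemma rat_padic_abs_inverse: "v (inverse x) = inverse (v x)"
proof (cases "x = 0")
  case False
  then have "v (inverse x) * v x = 1"
    by (simp flip: rat_padic_abs_mult)
  then show ?thesis by (metis inverse_unique mult.commute)
qed simp

lemma rat_padic_abs_ultra: "v (x + y) \<le> max (v x) (v y)"
proof (cases "x = 0 \<or> y = 0 \<or> x + y = 0")
  case False
  obtain a b where ab: "b > 0" "x = of_int a / of_int b" by (rule rat_cases_quot)
  obtain c d where cd: "d > 0" "y = of_int c / of_int d" by (rule rat_cases_quot)
  let ?m = "\<lambda>z. int (multiplicity (int p) z)"
  define A B D where "A = a * d" and "B = c * b" and "D = b * d"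
  have D: "D \<noteq> 0" "x = of_int A / of_int D" "y = of_int B / of_int D"
    using ab cd by (auto simp: A_def B_def D_def)
  then have xy: "x + y = of_int (A + B) / of_int D" by (simp add: add_divide_distrib)
  have nz: "A \<noteq> 0" "B \<noteq> 0" "A + B \<noteq> 0" using False D xy by auto
  have p1: "real p \<ge> 1" "\<not> is_unit (int p)" using p prime_ge_1_nat by auto
  let ?k = "min (multiplicity (int p) A) (multiplicity (int p) B)"
  have "int p ^ ?k dvd A + B"
    by (intro dvd_add) (auto intro: multiplicity_dvd')
  then have "?k \<le> multiplicity (int p) (A + B)"
    using nz p1 by (intro multiplicity_geI) auto
  then have "?m D - ?m (A + B) \<le> ?m D - ?m A \<or> ?m D - ?m (A + B) \<le> ?m D - ?m B"
    by linarith
  then have "real p powi (?m D - ?m (A + B)) \<le> real p powi (?m D - ?m A)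
           \<or> real p powi (?m D - ?m (A + B)) \<le> real p powi (?m D - ?m B)"
    using p1 by (auto intro: power_int_increasing)
  then have "v (x + y) \<le> v x \<or> v (x + y) \<le> v y"
    unfolding xy unfolding D(2,3) rat_padic_abs_quot[OF nz(1) D(1)]
      rat_padic_abs_quot[OF nz(2) D(1)] rat_padic_abs_quot[OF nz(3) D(1)] .
  then show ?thesis by linarith
qed (auto simp: max_def)

lemma rat_padic_abs_triangle: "v (x + y) \<le> v x + v y"
  using rat_padic_abs_ultra[of x y] rat_padic_abs_nonneg[of x] rat_padic_abs_nonneg[of y]
  by linarith

lemma rat_padic_abs_diff_le: "\<bar>v x - v y\<bar> \<le> v (x - y)"
  using rat_padic_abs_triangle[of "x - y" y] rat_padic_abs_triangle[of "y - x" x]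
    rat_padic_abs_minus_commute[of x y] by simp

lemma padic_vanishes_const [simp]: "padic_vanishes p (\<lambda>n. c) \<longleftrightarrow> c = 0"
  by (simp add: padic_vanishes_def LIMSEQ_const_iff)

lemma padic_vanishes_minus: "padic_vanishes p X \<Longrightarrow> padic_vanishes p (\<lambda>n. - X n)"
  by (simp add: padic_vanishes_def)

lemma padic_vanishes_add:
  assumes "padic_vanishes p X" "padic_vanishes p Y"
  shows "padic_vanishes p (\<lambda>n. X n + Y n)"
proof -
  have "(\<lambda>n. v (X n) + v (Y n)) \<longlonglongrightarrow> 0"
    using tendsto_add[of "\<lambda>n. v (X n)" 0 _ "\<lambda>n. v (Y n)" 0] assms
    by (simp add: padic_vanishes_def)
  then show ?thesis
    unfolding padic_vanishes_def
    by (rule Lim_null_comparison[rotated])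
       (simp add: rat_padic_abs_triangle)
qed

lemma padic_vanishes_mult_bounded:
  assumes "\<And>n. v (X n) \<le> B" "padic_vanishes p Y"
  shows "padic_vanishes p (\<lambda>n. X n * Y n)"
proof -
  have "(\<lambda>n. B * v (Y n)) \<longlonglongrightarrow> 0"
    using tendsto_mult_right_zero[of "\<lambda>n. v (Y n)" _ B] assms
    by (simp add: padic_vanishes_def)
  then show ?thesis
    unfolding padic_vanishes_def
    by (rule Lim_null_comparison[rotated])
       (simp add: rat_padic_abs_mult mult_right_mono assms)
qed

lemma padic_cauchy_const [simp]: "padic_cauchy p (\<lambda>n. c)"
  by (auto simp: padic_cauchy_def)

lemma padic_cauchy_minus: "padic_cauchy p X \<Longrightarrow> padic_cauchy p (\<lambda>n. - X n)"
  using rat_padic_abs_minus_commute by (simp add: padic_cauchy_def)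

lemma padic_cauchy_add:
  assumes "padic_cauchy p X" "padic_cauchy p Y"
  shows "padic_cauchy p (\<lambda>n. X n + Y n)"
  unfolding padic_cauchy_def
proof (intro allI impI)
  fix e :: real assume e: "e > 0"
  obtain i where i: "\<And>m n. m \<ge> i \<Longrightarrow> n \<ge> i \<Longrightarrow> v (X m - X n) < e"
    using assms(1) e by (meson padic_cauchy_def)
  obtain j where j: "\<And>m n. m \<ge> j \<Longrightarrow> n \<ge> j \<Longrightarrow> v (Y m - Y n) < e"
    using assms(2) e by (meson padic_cauchy_def)
  have "v (X m + Y m - (X n + Y n)) < e" if "m \<ge> max i j" "n \<ge> max i j" for m n
    using rat_padic_abs_ultra[of "X m - X n" "Y m - Y n"] i[of m n] j[of m n] that
    by (simp add: algebra_simps)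
  then show "\<exists>k. \<forall>m\<ge>k. \<forall>n\<ge>k. v (X m + Y m - (X n + Y n)) < e" by blast
qed

lemma padic_cauchy_norm_convergent:
  assumes "padic_cauchy p X"
  shows "convergent (\<lambda>n. v (X n))"
proof -
  have "Cauchy (\<lambda>n. v (X n))"
    unfolding Cauchy_def dist_real_def
    using assms unfolding padic_cauchy_def
    by (meson rat_padic_abs_diff_le le_less_trans)
  then show ?thesis by (simp add: Cauchy_convergent_iff)
qed

lemma padic_cauchy_bounded:
  assumes "padic_cauchy p X"
  obtains B where "B > 0" "\<And>n. v (X n) \<le> B"
proof -
  have "Bseq (\<lambda>n. v (X n))"
    using padic_cauchy_norm_convergent[OF assms] by (rule convergent_imp_Bseq)
  then show ?thesis using that by (auto simp: Bseq_def)
qed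

lemma padic_cauchy_mult:
  assumes "padic_cauchy p X" "padic_cauchy p Y"
  shows "padic_cauchy p (\<lambda>n. X n * Y n)"
  unfolding padic_cauchy_def
proof (intro allI impI)
  fix e :: real assume e: "e > 0"
  obtain A where A: "A > 0" "\<And>n. v (X n) \<le> A" using padic_cauchy_bounded[OF assms(1)] by blast
  obtain B where B: "B > 0" "\<And>n. v (Y n) \<le> B" using padic_cauchy_bounded[OF assms(2)] by blast
  have eA: "e / A > 0" and eB: "e / B > 0" using e A B by auto
  obtain i where i: "\<And>m n. m \<ge> i \<Longrightarrow> n \<ge> i \<Longrightarrow> v (X m - X n) < e / B"
    using assms(1) eB by (meson padic_cauchy_def)
  obtain j where j: "\<And>m n. m \<ge> j \<Longrightarrow> n \<ge> j \<Longrightarrow> v (Y m - Y n) < e / A"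
    using assms(2) eA by (meson padic_cauchy_def)
  have "v (X m * Y m - X n * Y n) < e" if "m \<ge> max i j" "n \<ge> max i j" for m n
  proof -
    have "v (X m * (Y m - Y n)) \<le> A * v (Y m - Y n)"
      by (simp add: rat_padic_abs_mult mult_right_mono A)
    also have "\<dots> < e" using j[of m n] that A by (simp add: field_simps)
    finally have 1: "v (X m * (Y m - Y n)) < e" .
    have "v ((X m - X n) * Y n) \<le> v (X m - X n) * B"
      by (simp add: rat_padic_abs_mult mult_left_mono B)
    also have "\<dots> < e" using i[of m n] that B by (simp add: field_simps)
    finally have 2: "v ((X m - X n) * Y n) < e" .
    show ?thesis
      using rat_padic_abs_ultra[of "X m * (Y m - Y n)" "(X m - X n) * Y n"] 1 2
      by (simp add: algebra_simps)
  qed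
  then show "\<exists>k. \<forall>m\<ge>k. \<forall>n\<ge>k. v (X m * Y m - X n * Y n) < e" by blast
qed

lemma padic_cauchy_not_vanishes:
  assumes "padic_cauchy p X" "\<not> padic_vanishes p X"
  obtains b k where "b > 0" "\<And>n. n \<ge> k \<Longrightarrow> v (X n) > b"
proof -
  obtain L where L: "(\<lambda>n. v (X n)) \<longlonglongrightarrow> L"
    using padic_cauchy_norm_convergent[OF assms(1)] by (auto simp: convergent_def)
  have "L \<ge> 0" by (rule LIMSEQ_le_const[OF L]) auto
  moreover have "L \<noteq> 0" using L assms(2) by (auto simp: padic_vanishes_def)
  ultimately have "L / 2 > 0" "L / 2 < L" by auto
  moreover obtain k where "\<forall>n\<ge>k. v (X n) > L / 2"
    using order_tendstoD(1)[OF L \<open>L / 2 < L\<close>] unfolding eventually_sequentially by blast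
  ultimately show ?thesis using that by blast
qed

private lemma mult_ac_swap: "a * b * c = b * (a * c)" for a b c :: real
  by simp

lemma padic_cauchy_inverse:
  assumes "padic_cauchy p X" "\<not> padic_vanishes p X"
  shows "padic_cauchy p (\<lambda>n. inverse (X n))"
  unfolding padic_cauchy_def
proof (intro allI impI)
  fix e :: real assume e: "e > 0"
  obtain b k where b: "b > 0" "\<And>n. n \<ge> k \<Longrightarrow> v (X n) > b"
    using padic_cauchy_not_vanishes[OF assms] by blast
  have "b * e * b > 0" using b e by simp
  then obtain i where i: "\<And>m n. m \<ge> i \<Longrightarrow> n \<ge> i \<Longrightarrow> v (X m - X n) < b * e * b"
    using assms(1) by (meson padic_cauchy_def)
  have "v (inverse (X m) - inverse (X n)) < e" if mn: "m \<ge> max i k" "n \<ge> max i k" for m n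
  proof -
    have bm: "v (X m) > b" and bn: "v (X n) > b" using b mn by auto
    then have nz: "X m \<noteq> 0" "X n \<noteq> 0" using b by auto
    have "v (inverse (X m) - inverse (X n)) = v (X m - X n) / (v (X m) * v (X n))"
      unfolding inverse_diff_inverse[OF nz] rat_padic_abs_minus rat_padic_abs_mult
        rat_padic_abs_inverse divide_inverse inverse_mult_distrib by (rule mult_ac_swap)
    also have "\<dots> < e"
    proof -
      have "b * b \<le> v (X m) * v (X n)" using bm bn b by (intro mult_mono) auto
      then have "b * e * b \<le> e * (v (X m) * v (X n))" using e by (simp add: mult.left_commute)
      with i[of m n] mn have "v (X m - X n) < e * (v (X m) * v (X n))" by simp
      then show ?thesis using bm bn b by (simp add: divide_less_eq)
    qed
    finally show ?thesis .
  qed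
  then show "\<exists>k. \<forall>m\<ge>k. \<forall>n\<ge>k. v (inverse (X m) - inverse (X n)) < e" by blast
qed

lemma padic_vanishes_cong:
  assumes "padic_vanishes p (\<lambda>n. X n - Y n)"
  shows "padic_vanishes p X \<longleftrightarrow> padic_vanishes p Y"
  using padic_vanishes_add[OF assms, of Y]
    padic_vanishes_add[OF padic_vanishes_minus[OF assms], of X] by auto

lemma padic_vanishes_eventually_cong:
  assumes "\<And>n. n \<ge> k \<Longrightarrow> X n = Y n"
  shows "padic_vanishes p X \<longleftrightarrow> padic_vanishes p Y"
  unfolding padic_vanishes_def
  using assms by (intro tendsto_cong eventually_sequentiallyI[of k]) simp

lemma padic_vanishes_inverse_mult:
  assumes "padic_cauchy p X" "\<not> padic_vanishes p X"
  shows "padic_vanishes p (\<lambda>n. inverse (X n) * X n - 1)"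
proof -
  obtain b k where b: "b > 0" "\<And>n. n \<ge> k \<Longrightarrow> v (X n) > b"
    using padic_cauchy_not_vanishes[OF assms] by blast
  have "inverse (X n) * X n - 1 = 0" if "n \<ge> k" for n
  proof -
    have "X n \<noteq> 0" using b(1) b(2)[OF that] by auto
    then show ?thesis by simp
  qed
  then show ?thesis
    using padic_vanishes_eventually_cong[of k "\<lambda>n. inverse (X n) * X n - 1" "\<lambda>_. 0"] by simp
qed

lemma padic_vanishes_diff_mult:
  assumes "padic_cauchy p X" "padic_cauchy p Y'"
    and "padic_vanishes p (\<lambda>n. X n - X' n)" "padic_vanishes p (\<lambda>n. Y n - Y' n)"
  shows "padic_vanishes p (\<lambda>n. X n * Y n - X' n * Y' n)"
proof -
  obtain A where A: "\<And>n. v (X n) \<le> A" using padic_cauchy_bounded[OF assms(1)] by metis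
  obtain B where B: "\<And>n. v (Y' n) \<le> B" using padic_cauchy_bounded[OF assms(2)] by metis
  have "padic_vanishes p (\<lambda>n. X n * (Y n - Y' n) + Y' n * (X n - X' n))"
    by (intro padic_vanishes_add padic_vanishes_mult_bounded[OF A]
        padic_vanishes_mult_bounded[OF B] assms)
  then show ?thesis by (simp add: algebra_simps)
qed

lemma padic_vanishes_diff_inverse:
  assumes X: "padic_cauchy p X" "\<not> padic_vanishes p X"
    and Y: "padic_cauchy p Y" "\<not> padic_vanishes p Y"
    and XY: "padic_vanishes p (\<lambda>n. X n - Y n)"
  shows "padic_vanishes p (\<lambda>n. inverse (X n) - inverse (Y n))"
proof -
  obtain b k where b: "b > 0" "\<And>n. n \<ge> k \<Longrightarrow> v (X n) > b"
    using padic_cauchy_not_vanishes[OF X] by blast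
  obtain c l where c: "c > 0" "\<And>n. n \<ge> l \<Longrightarrow> v (Y n) > c"
    using padic_cauchy_not_vanishes[OF Y] by blast
  obtain B where B: "\<And>n. v (inverse (X n) * inverse (Y n)) \<le> B"
    using padic_cauchy_bounded[OF padic_cauchy_mult[OF padic_cauchy_inverse[OF X]
          padic_cauchy_inverse[OF Y]]] by metis
  have "padic_vanishes p (\<lambda>n. (inverse (X n) * inverse (Y n)) * - (X n - Y n))"
    by (intro padic_vanishes_mult_bounded[OF B] padic_vanishes_minus XY)
  moreover have "(inverse (X n) * inverse (Y n)) * - (X n - Y n) = inverse (X n) - inverse (Y n)"
    if "n \<ge> max k l" for n
  proof -
    have "X n \<noteq> 0" "Y n \<noteq> 0" using b(1) b(2)[of n] c(1) c(2)[of n] that by auto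
    then show ?thesis by (simp add: field_simps)
  qed
  ultimately show ?thesis
    using padic_vanishes_eventually_cong[of "max k l"
        "\<lambda>n. (inverse (X n) * inverse (Y n)) * - (X n - Y n)"] by simp
qed

lemma padic_rel_refl: "padic_cauchy p X \<Longrightarrow> padic_rel p X X"
  by (simp add: padic_rel_def)

lemma padic_rel_sym: "padic_rel p X Y \<Longrightarrow> padic_rel p Y X"
  using padic_vanishes_minus[of "\<lambda>n. X n - Y n"] by (simp add: padic_rel_def)

lemma padic_rel_trans: "padic_rel p X Y \<Longrightarrow> padic_rel p Y Z \<Longrightarrow> padic_rel p X Z"
  using padic_vanishes_add[of "\<lambda>n. X n - Y n" "\<lambda>n. Y n - Z n"] by (simp add: padic_rel_def)

lemma padic_rel_add:
  assumes "padic_rel p X X'" "padic_rel p Y Y'"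
  shows "padic_rel p (\<lambda>n. X n + Y n) (\<lambda>n. X' n + Y' n)"
  using assms padic_vanishes_add[of "\<lambda>n. X n - X' n" "\<lambda>n. Y n - Y' n"]
  by (simp add: padic_rel_def padic_cauchy_add add_diff_add)

lemma padic_rel_uminus:
  assumes "padic_rel p X Y"
  shows "padic_rel p (\<lambda>n. - X n) (\<lambda>n. - Y n)"
  using assms padic_vanishes_minus[of "\<lambda>n. X n - Y n"]
  by (simp add: padic_rel_def padic_cauchy_minus)

lemma padic_rel_mult:
  assumes "padic_rel p X X'" "padic_rel p Y Y'"
  shows "padic_rel p (\<lambda>n. X n * Y n) (\<lambda>n. X' n * Y' n)"
  using assms padic_vanishes_diff_mult[of X Y' X' Y]
  by (simp add: padic_rel_def padic_cauchy_mult)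

lemma padic_rel_inverse:
  assumes "padic_rel p X Y"
  shows "padic_rel p (if padic_vanishes p X then (\<lambda>n. 0) else (\<lambda>n. inverse (X n)))
                     (if padic_vanishes p Y then (\<lambda>n. 0) else (\<lambda>n. inverse (Y n)))"
proof -
  have "padic_cauchy p X" "padic_cauchy p Y" "padic_vanishes p (\<lambda>n. X n - Y n)"
    using assms by (auto simp: padic_rel_def)
  then show ?thesis
    using padic_vanishes_cong[of X Y] padic_vanishes_diff_inverse[of X Y]
    by (cases "padic_vanishes p X") (simp_all add: padic_rel_def padic_cauchy_inverse)
qed

lemma padic_rel_lim_eq:
  assumes "padic_rel p X Y"
  shows "lim (\<lambda>n. v (X n)) = lim (\<lambda>n. v (Y n))"
proof -
  have XY: "(\<lambda>n. v (X n - Y n)) \<longlonglongrightarrow> 0" and Y: "padic_cauchy p Y"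
    using assms by (auto simp: padic_rel_def padic_vanishes_def)
  have "(\<lambda>n. v (X n) - v (Y n)) \<longlonglongrightarrow> 0"
    by (rule Lim_null_comparison[OF _ XY]) (simp add: rat_padic_abs_diff_le)
  moreover have "(\<lambda>n. v (Y n)) \<longlonglongrightarrow> lim (\<lambda>n. v (Y n))"
    using padic_cauchy_norm_convergent[OF Y] by (simp add: convergent_LIMSEQ_iff)
  ultimately have "(\<lambda>n. v (X n)) \<longlonglongrightarrow> lim (\<lambda>n. v (Y n))"
    using tendsto_add[of "\<lambda>n. v (X n) - v (Y n)" 0 _ "\<lambda>n. v (Y n)"] by fastforce
  then show ?thesis by (rule limI)
qed

end

section \<open>The field of \<open>p\<close>-adic numbers\<close>

text \<open>
  The prime \<open>p\<close> is carried by a type variable \<open>'p\<close> of class \<open>prime_card\<close>, through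
  \<open>p = CARD('p)\<close>. The type \<open>'p padic\<close> is the completion of the rationals with respect to
  the \<open>p\<close>-adic absolute value: Cauchy sequences modulo null sequences. The command
  quotient type does not support a parameter that is absent from the raw type, hence the
  explicit type definition.
\<close>

typedef ('p :: prime_card) padic =
  "{c. \<exists>X. padic_cauchy CARD('p) X \<and> c = {Y. padic_rel CARD('p) X Y}}"
  using padic_cauchy_const[OF prime_card] by blast

definition Padic :: "(nat \<Rightarrow> rat) \<Rightarrow> 'p :: prime_card padic" where
  "Padic X = Abs_padic {Y. padic_rel CARD('p) X Y}"

definition rep_padic :: "'p :: prime_card padic \<Rightarrow> nat \<Rightarrow> rat" where
  "rep_padic x = (SOME X. X \<in> Rep_padic x)"

definition cr_padic :: "(nat \<Rightarrow> rat) \<Rightarrow> 'p :: prime_card padic \<Rightarrow> bool" where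
  "cr_padic X x \<longleftrightarrow> padic_cauchy CARD('p) X \<and> Padic X = x"

lemma Quotient_padic:
  "Quotient (padic_rel CARD('p)) Padic rep_padic (cr_padic :: _ \<Rightarrow> 'p :: prime_card padic \<Rightarrow> _)"
proof -
  let ?R = "padic_rel CARD('p)"
  note pr = prime_card[where 'a = 'p]
  have Rep: "Rep_padic (Padic X :: 'p padic) = {Y. ?R X Y}" if "padic_cauchy CARD('p) X" for X
    unfolding Padic_def using that by (intro Abs_padic_inverse) auto
  have rep: "padic_cauchy CARD('p) (rep_padic x) \<and> Padic (rep_padic x) = x" for x :: "'p padic"
  proof -
    obtain X where X: "padic_cauchy CARD('p) X" "Rep_padic x = {Y. ?R X Y}"
      using Rep_padic[of x] by auto
    then have "X \<in> Rep_padic x" using padic_rel_refl[OF pr] by simp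
    then have "rep_padic x \<in> Rep_padic x"
      unfolding rep_padic_def by (rule someI[where P = "\<lambda>X. X \<in> Rep_padic x"])
    then have XR: "?R X (rep_padic x)" using X by simp
    then have "{Y. ?R X Y} = {Y. ?R (rep_padic x) Y}"
      using padic_rel_sym[OF pr] padic_rel_trans[OF pr] by blast
    then have "Padic (rep_padic x) = x"
      unfolding Padic_def using X by (metis Rep_padic_inverse)
    then show ?thesis using XR by (simp add: padic_rel_def)
  qed
  have eq: "?R X Y \<longleftrightarrow> padic_cauchy CARD('p) X \<and> padic_cauchy CARD('p) Y
              \<and> (Padic X :: 'p padic) = Padic Y" for X Y
  proof
    assume "?R X Y"
    moreover from this have "{Z. ?R X Z} = {Z. ?R Y Z}"
      using padic_rel_sym[OF pr] padic_rel_trans[OF pr] by blast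
    ultimately show "padic_cauchy CARD('p) X \<and> padic_cauchy CARD('p) Y
              \<and> (Padic X :: 'p padic) = Padic Y"
      by (simp add: Padic_def padic_rel_def)
  next
    assume "padic_cauchy CARD('p) X \<and> padic_cauchy CARD('p) Y \<and> (Padic X :: 'p padic) = Padic Y"
    then show "?R X Y" using Rep[of X] Rep[of Y] padic_rel_refl[OF pr, of Y] by auto
  qed
  show ?thesis
    unfolding Quotient_alt_def cr_padic_def using rep eq by auto
qed

setup_lifting Quotient_padic

instantiation padic :: (prime_card) field
begin

lift_definition zero_padic :: "'a padic" is "\<lambda>n. 0"
  by (simp add: padic_rel_refl prime_card)

lift_definition one_padic :: "'a padic" is "\<lambda>n. 1"
  by (simp add: padic_rel_refl prime_card)

lift_definition plus_padic :: "'a padic \<Rightarrow> 'a padic \<Rightarrow> 'a padic" is "\<lambda>X Y n. X n + Y n"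
  by (rule padic_rel_add[OF prime_card])

lift_definition uminus_padic :: "'a padic \<Rightarrow> 'a padic" is "\<lambda>X n. - X n"
  by (rule padic_rel_uminus[OF prime_card])

lift_definition times_padic :: "'a padic \<Rightarrow> 'a padic \<Rightarrow> 'a padic" is "\<lambda>X Y n. X n * Y n"
  by (rule padic_rel_mult[OF prime_card])

lift_definition inverse_padic :: "'a padic \<Rightarrow> 'a padic"
  is "\<lambda>X. if padic_vanishes CARD('a) X then (\<lambda>n. 0) else (\<lambda>n. inverse (X n))"
  by (rule padic_rel_inverse[OF prime_card])

definition "x - y = x + - y" for x y :: "'a padic"

definition "x div y = x * inverse y" for x y :: "'a padic"

instance
proof
  note [simp] = padic_rel_def prime_card padic_cauchy_add padic_cauchy_mult padic_cauchy_minus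
    padic_cauchy_inverse
  fix a b c :: "'a padic"
  show "a + b = b + a" by transfer (simp add: ac_simps)
  show "(a + b) + c = a + (b + c)" by transfer (simp add: ac_simps)
  show "0 + a = a" by transfer simp
  show "- a + a = 0" by transfer simp
  show "a - b = a + - b" by (rule minus_padic_def)
  show "(a * b) * c = a * (b * c)" by transfer (simp add: ac_simps)
  show "a * b = b * a" by transfer (simp add: ac_simps)
  show "1 * a = a" by transfer simp
  show "(a + b) * c = a * c + b * c" by transfer (simp add: distrib_right)
  show "(0 :: 'a padic) \<noteq> 1" by transfer simp
  show "a \<noteq> 0 \<Longrightarrow> inverse a * a = 1"
    by transfer (simp add: padic_vanishes_inverse_mult)
  show "a div b = a * inverse b" by (rule divide_padic_def)
  show "inverse (0 :: 'a padic) = 0" by transfer simp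
qed

end

text \<open>The absolute value normalised by \<open>\<bar>p\<bar> = 1 / p\<close>.\<close>

lift_definition padic_norm :: "'p :: prime_card padic \<Rightarrow> real"
  is "\<lambda>X. lim (\<lambda>n. rat_padic_abs CARD('p) (X n))"
  by (rule padic_rel_lim_eq[OF prime_card])

lemma padic_norm_eq_0 [simp]: "padic_norm x = 0 \<longleftrightarrow> x = 0"
proof (transfer, goal_cases)
  case (1 X)
  then have X: "padic_cauchy CARD('a) X" by (simp add: padic_rel_def)
  then have "(\<lambda>n. rat_padic_abs CARD('a) (X n)) \<longlonglongrightarrow> lim (\<lambda>n. rat_padic_abs CARD('a) (X n))"
    using padic_cauchy_norm_convergent[OF prime_card] by (simp add: convergent_LIMSEQ_iff)
  then have "lim (\<lambda>n. rat_padic_abs CARD('a) (X n)) = 0 \<longleftrightarrow> padic_vanishes CARD('a) X"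
    unfolding padic_vanishes_def by (metis limI)
  then show ?case
    using X by (simp add: padic_rel_def prime_card)
qed

lemma padic_norm_minus [simp]: "padic_norm (- x) = padic_norm x"
  by transfer (simp add: prime_card)

lemma padic_norm_triangle: "padic_norm (x + y) \<le> padic_norm x + padic_norm y"
proof (transfer, goal_cases)
  case (1 X Y)
  let ?v = "rat_padic_abs CARD('a)"
  note pr = prime_card[where 'a = 'a]
  have X: "padic_cauchy CARD('a) X" and Y: "padic_cauchy CARD('a) Y"
    using 1 by (auto simp: padic_rel_def)
  have l: "(\<lambda>n. ?v (Z n)) \<longlonglongrightarrow> lim (\<lambda>n. ?v (Z n))" if "padic_cauchy CARD('a) Z" for Z
    using padic_cauchy_norm_convergent[OF pr that] by (simp add: convergent_LIMSEQ_iff)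
  show ?case
    by (rule LIMSEQ_le[OF l[OF padic_cauchy_add[OF pr X Y]] tendsto_add[OF l[OF X] l[OF Y]]])
       (simp add: rat_padic_abs_triangle[OF pr])
qed

instantiation padic :: (prime_card) metric_space
begin

definition dist_padic :: "'a padic \<Rightarrow> 'a padic \<Rightarrow> real" where
  "dist_padic x y = padic_norm (x - y)"

definition uniformity_padic :: "('a padic \<times> 'a padic) filter" where
  "uniformity_padic = (INF e\<in>{0 <..}. principal {(x, y). dist x y < e})"

definition open_padic :: "'a padic set \<Rightarrow> bool" where
  "open_padic U \<longleftrightarrow> (\<forall>x\<in>U. eventually (\<lambda>(x', y). x' = x \<longrightarrow> y \<in> U) uniformity)"

instance
proof
  fix x y z :: "'a padic"
  show "dist x y = 0 \<longleftrightarrow> x = y" by (simp add: dist_padic_def)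
  show "dist x y \<le> dist x z + dist y z"
    using padic_norm_triangle[of "x - z" "z - y"] padic_norm_minus[of "y - z"]
    by (simp add: dist_padic_def)
qed (fact uniformity_padic_def open_padic_def)+

end

definition padic_ints :: "'p :: prime_card padic set" where
  "padic_ints = {x. padic_norm x \<le> 1}"

text \<open>The absolute values on \<open>'p padic\<close> equivalent to the normalised one, i.e. its positive
  powers.\<close>

definition padic_absolute_value :: "('p :: prime_card padic \<Rightarrow> real) \<Rightarrow> bool" where
  "padic_absolute_value N \<longleftrightarrow> (\<exists>s>0. \<forall>x. N x = padic_norm x powr s)"

section \<open>Characters\<close>

definition padic_units_group :: "'p :: prime_card padic monoid" where
  "padic_units_group = \<lparr>carrier = - {0}, mult = (*), one = 1\<rparr>"

definition padic_ints_group :: "'p :: prime_card padic monoid" where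
  "padic_ints_group = \<lparr>carrier = padic_ints, mult = (+), one = 0\<rparr>"

text \<open>The topological group is given by a group \<open>G\<close> with a topology \<open>T\<close> on its carrier.\<close>

definition padic_character ::
    "('a, 'b) monoid_scheme \<Rightarrow> 'a topology \<Rightarrow> ('a \<Rightarrow> 'p :: prime_card padic) \<Rightarrow> bool" where
  "padic_character G T chi \<longleftrightarrow>
     chi \<in> hom G padic_units_group \<and> continuous_map T (top_of_set (- {0})) chi"

section \<open>Vectors and matrices\<close>

definition vecs_over :: "nat \<Rightarrow> 'a set \<Rightarrow> 'a vec set" where
  "vecs_over n S = {x \<in> carrier_vec n. set\<^sub>v x \<subseteq> S}"

definition mats_over :: "nat \<Rightarrow> nat \<Rightarrow> 'a set \<Rightarrow> 'a mat set" where
  "mats_over m n S = {A \<in> carrier_mat m n. elements_mat A \<subseteq> S}"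

text \<open>The product topology on \<open>S\<^sup>n\<close>, transported from functions on \<open>{..<n}\<close> to vectors.\<close>

definition vec_topology :: "nat \<Rightarrow> 'a :: topological_space set \<Rightarrow> 'a vec topology" where
  "vec_topology n S =
     pullback_topology (vecs_over n S) (\<lambda>x. restrict (vec_index x) {..<n})
       (product_topology (\<lambda>_. top_of_set S) {..<n})"

text \<open>The element \<open>0\<close> only matters for vectors of dimension \<open>0\<close>, as \<open>N\<close> is non-negative.\<close>

definition linf_norm :: "('a \<Rightarrow> real) \<Rightarrow> 'a vec \<Rightarrow> real" where
  "linf_norm N x = Max (insert 0 (N ` set\<^sub>v x))"

end

theory Submission
  imports Defs
begin

unbundle no inner_syntax
no_notation vec_nth (infixl \<open>$\<close> 90)

text \<open>
  This is Kaplansky's \<open>p\<close>-adic Stone--Weierstrass theorem applied to the span of the functions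
  \<open>x \<mapsto> \<chi> (a \<bullet> x)\<close>, which is an algebra because \<open>\<chi>\<close> is a homomorphism and separates points because
  \<open>\<chi>\<close> is injective; the shift \<open>b\<close> can be taken to be \<open>0\<close>.

  For Kaplansky's theorem, let \<open>g\<close> be a function bounded by \<open>1\<close> in the uniform closure of a separating
  algebra. By Fermat's little theorem the powers \<open>g ^ ((p - 1) * p ^ k)\<close> converge uniformly to the
  indicator function of \<open>\<bar>g\<bar> = 1\<close>. Applying this to \<open>g / p ^ k\<close> on the set \<open>\<bar>g\<bar> \<le> p ^ (- k)\<close>,
  the closure contains by induction the indicator functions of all these sets. By compactness, each
  point has arbitrarily small clopen neighbourhoods with indicator function in the closure, so each
  continuous function is a uniform limit of step functions in the closure.
\<close>

section \<open>Arithmetic of the \<open>p\<close>-adic norm\<close>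

text \<open>\<open>padic_norm\<close> is given by \<open>lim\<close>, a choice operator that says
  something only for convergent sequences. Along a Cauchy sequence the absolute values do converge,
  so limit laws carry properties of \<open>rat_padic_abs\<close> over to
  \<open>padic_norm\<close>.\<close>

lemma padic_norm_Padic_tendsto:
  assumes "padic_cauchy CARD('p) X"
  shows "(\<lambda>n. rat_padic_abs CARD('p) (X n)) \<longlonglongrightarrow> padic_norm (Padic X :: 'p :: prime_card padic)"
proof -
  have "padic_norm (Padic X :: 'p padic) = lim (\<lambda>n. rat_padic_abs CARD('p) (X n))"
    by (metis assms padic_norm.abs_eq padic_rel_refl prime_card)
  then show ?thesis
    using padic_cauchy_norm_convergent[OF prime_card assms] by (simp add: convergent_LIMSEQ_iff)
qed

lemma padic_cases:
  fixes x :: "'p :: prime_card padic"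
  obtains X where "padic_cauchy CARD('p) X" "x = Padic X"
  using Quotient_padic[where 'p = 'p] unfolding Quotient_alt_def
  by (metis cr_padic_def)

lemma Padic_diff:
  assumes "padic_cauchy CARD('p) X" "padic_cauchy CARD('p) Y"
  shows "(Padic X - Padic Y :: 'p :: prime_card padic) = Padic (\<lambda>n. X n - Y n)"
  using assms
  by (simp add: minus_padic_def plus_padic.abs_eq uminus_padic.abs_eq padic_rel_refl prime_card
      padic_cauchy_minus)

lemma padic_norm_mult: "padic_norm (x * y) = padic_norm x * padic_norm (y :: 'p :: prime_card padic)"
proof -
  obtain X where X: "padic_cauchy CARD('p) X" "x = Padic X" by (rule padic_cases)
  obtain Y where Y: "padic_cauchy CARD('p) Y" "y = Padic Y" by (rule padic_cases)
  have "x * y = Padic (\<lambda>n. X n * Y n)"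
    using X Y by (simp add: times_padic.abs_eq padic_rel_refl prime_card)
  moreover have "(\<lambda>n. rat_padic_abs CARD('p) (X n * Y n)) \<longlonglongrightarrow> padic_norm x * padic_norm y"
    using tendsto_mult[OF padic_norm_Padic_tendsto[OF X(1)] padic_norm_Padic_tendsto[OF Y(1)]] X Y
    by (simp add: rat_padic_abs_mult prime_card)
  ultimately show ?thesis
    using padic_norm_Padic_tendsto[OF padic_cauchy_mult[OF prime_card X(1) Y(1)]] LIMSEQ_unique
    by metis
qed

text \<open>The rational inequality holds term by term, and non-strict inequalities survive
  limits.\<close>

lemma padic_norm_ultra:
  fixes x y :: "'p :: prime_card padic"
  shows "padic_norm (x + y) \<le> max (padic_norm x) (padic_norm y)"
proof -
  obtain X where X: "padic_cauchy CARD('p) X" "x = Padic X" by (rule padic_cases)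
  obtain Y where Y: "padic_cauchy CARD('p) Y" "y = Padic Y" by (rule padic_cases)
  have "x + y = Padic (\<lambda>n. X n + Y n)"
    using X Y by (simp add: plus_padic.abs_eq padic_rel_refl prime_card)
  moreover have "(\<lambda>n. max (rat_padic_abs CARD('p) (X n)) (rat_padic_abs CARD('p) (Y n)))
      \<longlonglongrightarrow> max (padic_norm x) (padic_norm y)"
    using tendsto_max[OF padic_norm_Padic_tendsto[OF X(1)] padic_norm_Padic_tendsto[OF Y(1)]] X Y
    by simp
  ultimately show ?thesis
    using LIMSEQ_le[OF padic_norm_Padic_tendsto[OF padic_cauchy_add[OF prime_card X(1) Y(1)]]]
    by (simp add: rat_padic_abs_ultra[OF prime_card])
qed

lemma padic_norm_0 [simp]: "padic_norm 0 = 0"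
  by simp

text \<open>The triangle inequality for \<open>x + - x = 0\<close>, where both summands have the
  same norm.\<close>

lemma padic_norm_nonneg [simp]: "padic_norm x \<ge> 0"
  using padic_norm_triangle[of x "- x"] padic_norm_0 by (simp del: padic_norm_eq_0)

lemma padic_norm_1 [simp]: "padic_norm 1 = 1"
  using padic_norm_mult[of 1 1] padic_norm_eq_0[of 1] by (auto simp del: padic_norm_eq_0)

lemma padic_norm_pos: "x \<noteq> 0 \<Longrightarrow> padic_norm x > 0"
  using padic_norm_eq_0[of x] padic_norm_nonneg[of x] by linarith

lemma padic_norm_minus_commute: "padic_norm (x - y) = padic_norm (y - x)"
  using padic_norm_minus[of "x - y"] by simp

lemma padic_norm_power: "padic_norm (x ^ n) = padic_norm x ^ n"
  by (induction n) (simp_all add: padic_norm_mult)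

lemma padic_norm_inverse: "padic_norm (inverse x) = inverse (padic_norm x)"
proof (cases "x = 0")
  case False
  then have "padic_norm (inverse x) * padic_norm x = 1"
    by (simp flip: padic_norm_mult)
  then show ?thesis by (metis inverse_unique mult.commute)
qed simp

lemma padic_norm_add_less:
  "padic_norm x < e \<Longrightarrow> padic_norm y < e \<Longrightarrow> padic_norm (x + y) < e"
  using padic_norm_ultra[of x y] by linarith

lemma padic_norm_add_le:
  "padic_norm x \<le> e \<Longrightarrow> padic_norm y \<le> e \<Longrightarrow> padic_norm (x + y) \<le> e"
  using padic_norm_ultra[of x y] by linarith

lemma padic_norm_diff_less:
  "padic_norm x < e \<Longrightarrow> padic_norm y < e \<Longrightarrow> padic_norm (x - y) < e"
  using padic_norm_add_less[of x e "- y"] by simp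

lemma padic_norm_diff_le:
  "padic_norm x \<le> e \<Longrightarrow> padic_norm y \<le> e \<Longrightarrow> padic_norm (x - y) \<le> e"
  using padic_norm_add_le[of x e "- y"] by simp

lemma padic_norm_sum_le:
  "(\<And>i. i \<in> I \<Longrightarrow> padic_norm (f i) \<le> e) \<Longrightarrow> e \<ge> 0 \<Longrightarrow> padic_norm (sum f I) \<le> e"
  by (induction I rule: infinite_finite_induct) (auto intro: padic_norm_add_le)

text \<open>The isosceles principle: by the strong triangle inequality the two largest sides of a
  triangle are equal. It makes the norm locally constant away from 0.\<close>

lemma padic_norm_eq_of_diff_less:
  assumes "padic_norm (x - y) < padic_norm x"
  shows "padic_norm y = padic_norm x"
proof -
  have "padic_norm y \<le> max (padic_norm x) (padic_norm (x - y))"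
    using padic_norm_ultra[of x "y - x"] by (simp add: padic_norm_minus_commute)
  moreover have "padic_norm x \<le> max (padic_norm (x - y)) (padic_norm y)"
    using padic_norm_ultra[of "x - y" y] by simp
  ultimately show ?thesis using assms by linarith
qed

section \<open>The embedding of the rationals and the norms of integers\<close>

lift_definition padic_of_rat :: "rat \<Rightarrow> 'p :: prime_card padic" is "\<lambda>q n. q"
  by (simp add: padic_rel_refl prime_card)

lemma padic_of_rat_eq: "(padic_of_rat q :: 'p :: prime_card padic) = Padic (\<lambda>n. q)"
  by (rule padic_of_rat.abs_eq)

lemma padic_norm_of_rat:
  "padic_norm (padic_of_rat q :: 'p :: prime_card padic) = rat_padic_abs CARD('p) q"
  unfolding padic_of_rat_eq
  using padic_norm_Padic_tendsto[OF padic_cauchy_const[OF prime_card[where 'a = 'p], of q]]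
  by (simp add: LIMSEQ_const_iff)

lemma padic_of_rat_diff:
  "padic_of_rat (a - b) = (padic_of_rat a - padic_of_rat b :: 'p :: prime_card padic)"
  unfolding padic_of_rat_eq by (subst Padic_diff) (simp_all add: prime_card)

lemma padic_of_rat_add:
  "padic_of_rat (a + b) = (padic_of_rat a + padic_of_rat b :: 'p :: prime_card padic)"
  using padic_of_rat_diff[of "a + b" b, where 'p = 'p] by (simp add: algebra_simps)

lemma padic_of_rat_mult:
  "padic_of_rat (a * b) = (padic_of_rat a * padic_of_rat b :: 'p :: prime_card padic)"
  unfolding padic_of_rat_eq by (simp add: times_padic.abs_eq padic_rel_refl prime_card)

lemma padic_of_rat_of_int [simp]: "padic_of_rat (of_int k) = (of_int k :: 'p :: prime_card padic)"
proof -
  have 0: "padic_of_rat 0 = (0 :: 'p padic)" by (simp add: zero_padic_def padic_of_rat_eq)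
  have 1: "padic_of_rat 1 = (1 :: 'p padic)" by (simp add: one_padic_def padic_of_rat_eq)
  show ?thesis
    by (induction k rule: int_induct[where k = 0])
       (simp_all add: 0 1 padic_of_rat_add padic_of_rat_diff)
qed

lemma padic_norm_of_int_le_1 [simp]: "padic_norm (of_int k :: 'p :: prime_card padic) \<le> 1"
proof (cases "k = 0")
  case False
  have "padic_norm (of_int k :: 'p padic) = rat_padic_abs CARD('p) (of_int k)"
    by (simp flip: padic_norm_of_rat)
  also have "\<dots> = real CARD('p) powi (- int (multiplicity (int CARD('p)) k))"
    using rat_padic_abs_quot[OF prime_card[where 'a = 'p] False, of 1] by simp
  also have "\<dots> \<le> 1"
    using prime_ge_1_nat[OF prime_card[where 'a = 'p]]
    by (simp add: power_int_minus inverse_le_1_iff)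
  finally show ?thesis .
qed simp

lemma padic_norm_p: "padic_norm (of_nat CARD('p) :: 'p :: prime_card padic) = 1 / CARD('p)"
proof -
  have "padic_norm (of_int (int CARD('p)) :: 'p padic) = rat_padic_abs CARD('p) (of_int (int CARD('p)))"
    by (metis padic_norm_of_rat padic_of_rat_of_int)
  also have "\<dots> = real CARD('p) powi (- 1)"
    using rat_padic_abs_quot[OF prime_card[where 'a = 'p], of "int CARD('p)" 1]
      multiplicity_self[of "int CARD('p)"] prime_gt_1_nat[OF prime_card[where 'a = 'p]]
    by simp
  finally show ?thesis by (simp add: power_int_minus divide_inverse)
qed

text \<open>Translates congruences modulo a power of p into closeness for the norm.\<close>

lemma padic_norm_of_int_dvd:
  assumes "int CARD('p) ^ k dvd a"
  shows "padic_norm (of_int a :: 'p :: prime_card padic) \<le> 1 / real CARD('p) ^ k"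
proof -
  obtain c where "a = int CARD('p) ^ k * c" using assms by blast
  then have "padic_norm (of_int a :: 'p padic) = (1 / CARD('p)) ^ k * padic_norm (of_int c :: 'p padic)"
    by (simp add: padic_norm_mult padic_norm_power padic_norm_p)
  also have "\<dots> \<le> (1 / CARD('p)) ^ k * 1"
    by (intro mult_left_mono) auto
  finally show ?thesis by (simp add: power_divide)
qed

section \<open>Approximation by rationals and integers, and discreteness of the norm\<close>

lemma Padic_approx:
  assumes "padic_cauchy CARD('p) X" "e > 0"
  shows "\<exists>k. \<forall>m\<ge>k. padic_norm (Padic X - padic_of_rat (X m) :: 'p :: prime_card padic) < e"
proof -
  \<comment> \<open>Half of \<open>e\<close>, because the limit in \<open>n\<close> weakens the
    strict bound to a non-strict one.\<close>
  obtain k where k: "\<And>m n. m \<ge> k \<Longrightarrow> n \<ge> k \<Longrightarrow> rat_padic_abs CARD('p) (X m - X n) < e / 2"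
    using assms unfolding padic_cauchy_def by (meson half_gt_zero)
  have "padic_norm (Padic X - padic_of_rat (X m) :: 'p padic) < e" if "m \<ge> k" for m
  proof -
    have eq: "(Padic X - padic_of_rat (X m) :: 'p padic) = Padic (\<lambda>n. X n - X m)"
      unfolding padic_of_rat_eq using assms by (subst Padic_diff) (simp_all add: prime_card)
    have "padic_cauchy CARD('p) (\<lambda>n. X n - X m)"
      using padic_cauchy_add[OF prime_card assms(1) padic_cauchy_const[OF prime_card, of "- X m"]]
      by simp
    from LIMSEQ_le_const2[OF padic_norm_Padic_tendsto[OF this], of "e / 2"]
    have "padic_norm (Padic (\<lambda>n. X n - X m) :: 'p padic) \<le> e / 2"
      using k that less_imp_le by blast
    then show ?thesis using assms(2) eq by simp
  qed
  then show ?thesis by blast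
qed

lemma padic_of_rat_dense:
  fixes x :: "'p :: prime_card padic"
  assumes "e > 0"
  obtains q where "padic_norm (x - padic_of_rat q) < e"
  by (metis padic_cases Padic_approx assms order_refl)

text \<open>The value group is discrete: a nonzero \<open>x\<close> has the same norm as any
  rational close enough to it, hence an integral power of p, and such a power below 1 has exponent
  at most -1.\<close>

lemma padic_norm_less_1:
  assumes "padic_norm (x :: 'p :: prime_card padic) < 1"
  shows "padic_norm x \<le> 1 / CARD('p)"
proof (cases "x = 0")
  case False
  obtain q where "padic_norm (x - padic_of_rat q) < padic_norm x"
    using padic_of_rat_dense[OF padic_norm_pos[OF False]] .
  then have x: "padic_norm x = rat_padic_abs CARD('p) q"
    using padic_norm_eq_of_diff_less padic_norm_of_rat by metis
  moreover have "q \<noteq> 0" using x padic_norm_pos[OF False] by (auto simp: rat_padic_abs_def)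
  ultimately obtain k where k: "padic_norm x = real CARD('p) powi k"
    unfolding rat_padic_abs_def by auto
  have p: "real CARD('p) > 1" using prime_gt_1_nat[OF prime_card[where 'a = 'p]] by simp
  have "k \<le> -1"
  proof (rule ccontr)
    assume "\<not> k \<le> -1"
    then have "real CARD('p) powi 0 \<le> real CARD('p) powi k"
      using p by (intro power_int_increasing) auto
    then show False using assms k by simp
  qed
  then have "real CARD('p) powi k \<le> real CARD('p) powi (-1)"
    using p by (intro power_int_increasing) auto
  then show ?thesis using k by (simp add: power_int_minus divide_inverse)
qed simp

text \<open>The integers are dense in the unit ball. A rational close to \<open>x\<close> lies in
  the unit ball as well, so its reduced denominator is prime to p and can be inverted modulo
  \<open>p ^ k\<close>.\<close>

lemma padic_int_approx:
  fixes x :: "'p :: prime_card padic"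
  assumes "padic_norm x \<le> 1"
  obtains a :: int where "padic_norm (x - of_int a) \<le> 1 / real CARD('p) ^ k"
proof -
  let ?p = "int CARD('p)"
  have pp: "prime ?p" using prime_card by simp
  have "1 \<le> real CARD('p) ^ k" by (intro one_le_power) (simp add: Suc_leI)
  then have e: "1 / real CARD('p) ^ k > 0" "1 / real CARD('p) ^ k \<le> 1" by simp_all
  obtain q where q: "padic_norm (x - padic_of_rat q) < 1 / real CARD('p) ^ k"
    using padic_of_rat_dense[OF e(1), of x] .
  obtain c d where cd: "quotient_of q = (c, d)" by fastforce
  have d: "d > 0" "coprime c d" "q = of_int c / of_int d"
    using quotient_of_denom_pos[OF cd] quotient_of_coprime[OF cd] quotient_of_div[OF cd] by auto
  have dq: "padic_of_rat q * of_int d = (of_int c :: 'p padic)"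
    using padic_of_rat_mult[of q "of_int d", where 'p = 'p] d by simp
  have "padic_norm (padic_of_rat q :: 'p padic) \<le> 1"
    using padic_norm_diff_le[OF assms, of "x - padic_of_rat q"] q e by simp
  have nd: "\<not> ?p dvd d"
  \<comment> \<open>If p divided the denominator, it would not divide the numerator, and
    \<open>q\<close> would have absolute value at least p.\<close>
  proof
    assume pd: "?p dvd d"
    then have "\<not> ?p dvd c"
      using d(2) pp by (meson coprime_common_divisor not_prime_unit)
    then have m: "multiplicity ?p c = 0" by (rule not_dvd_imp_multiplicity_0)
    have "multiplicity ?p d \<ge> 1" using pd d(1) pp
      by (intro multiplicity_geI) auto
    then have "rat_padic_abs CARD('p) q \<ge> real CARD('p) powi 1"
      unfolding rat_padic_abs_def using cd m prime_ge_1_nat[OF prime_card[where 'a = 'p]] \<open>\<not> ?p dvd c\<close> d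
      by (auto intro!: self_le_power simp: Suc_le_eq)
    then show False
      using \<open>padic_norm (padic_of_rat q :: 'p padic) \<le> 1\<close> prime_gt_1_nat[OF prime_card[where 'a = 'p]]
      unfolding padic_norm_of_rat by simp
  qed
  then have "coprime d (?p ^ k)" using pp
    by (metis coprime_commute coprime_power_right_iff prime_imp_coprime)
  \<comment> \<open>The integer sought is \<open>c * d'\<close>, with the inverse \<open>d'\<close>
    of the denominator modulo \<open>p ^ k\<close> in place of division by \<open>d\<close>.\<close>
  then obtain d' where "[d * d' = 1] (mod ?p ^ k)"
    using cong_solve_coprime_int by blast
  then have "[c * (d * d') = c * 1] (mod ?p ^ k)" by (rule cong_scalar_left)
  then have "?p ^ k dvd c * (d * d') - c" by (simp add: cong_iff_dvd_diff)
  then have "padic_norm (of_int (c * (d * d') - c) :: 'p padic) \<le> 1 / real CARD('p) ^ k"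
    by (rule padic_norm_of_int_dvd)
  moreover have "of_int (c * (d * d') - c) = (of_int d :: 'p padic) * (of_int (c * d') - padic_of_rat q)"
    by (simp add: dq[symmetric] algebra_simps)
  \<comment> \<open>Hence the factor \<open>d\<close> can be cancelled from the estimate without
    loss.\<close>
  moreover have "padic_norm (of_int d :: 'p padic) = 1"
  proof (rule ccontr)
    assume "padic_norm (of_int d :: 'p padic) \<noteq> 1"
    moreover have "padic_norm (of_int d :: 'p padic) = rat_padic_abs CARD('p) (of_int d)"
      by (simp flip: padic_norm_of_rat)
    moreover have "\<dots> = 1"
      using rat_padic_abs_quot[OF prime_card[where 'a = 'p], of d 1] d(1) nd
      by (simp add: not_dvd_imp_multiplicity_0)
    ultimately show False by simp
  qed
  ultimately have "padic_norm (of_int (c * d') - padic_of_rat q :: 'p padic) \<le> 1 / real CARD('p) ^ k"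
    by (simp add: padic_norm_mult)
  then have "padic_norm ((x - padic_of_rat q) - (of_int (c * d') - padic_of_rat q)) \<le> 1 / real CARD('p) ^ k"
    by (rule padic_norm_diff_le[OF less_imp_le[OF q]])
  then show ?thesis using that[of "c * d'"] by simp
qed

text \<open>For \<open>k = 0\<close> this is Fermat's little theorem for a natural number congruent
  to \<open>u\<close>. In the induction step, \<open>w ^ p - 1\<close> is \<open>w - 1\<close> times
  the sum of the \<open>w ^ i\<close> with \<open>i < p\<close>; all these powers are 1 modulo p, so
  the sum is divisible by p and contributes another factor \<open>1 / p\<close>.\<close>

lemma padic_unit_power_near_1:
  fixes u :: "'p :: prime_card padic"
  assumes "padic_norm u = 1"
  shows "padic_norm (u ^ ((CARD('p) - 1) * CARD('p) ^ k) - 1) \<le> 1 / real CARD('p) ^ Suc k"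
proof (induction k)
  case 0
  let ?p = "CARD('p)"
  have p1: "1 < real ?p" using prime_gt_1_nat[OF prime_card[where 'a = 'p]] by simp
  obtain a0 where a0: "padic_norm (u - of_int a0) \<le> 1 / ?p"
    using padic_int_approx[of u 1] assms by auto
  \<comment> \<open>\<open>fermat_theorem\<close> concerns natural numbers, so the integer
    approximation is replaced by its residue.\<close>
  define a where "a = nat (a0 mod int ?p)"
  have "int a = a0 mod int ?p" unfolding a_def by simp
  then have "int ?p ^ 1 dvd a0 - int a" by (simp add: mod_eq_dvd_iff[symmetric])
  from padic_norm_of_int_dvd[OF this] have "padic_norm (of_int (a0 - int a) :: 'p padic) \<le> 1 / ?p" by simp
  then have "padic_norm ((u - of_int a0) + of_int (a0 - int a)) \<le> 1 / ?p"
    by (rule padic_norm_add_le[OF a0])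
  then have a: "padic_norm (u - of_nat a) \<le> 1 / ?p" by simp
  have less: "1 / real ?p < 1" using p1 by simp
  have na: "padic_norm (of_nat a :: 'p padic) = 1"
    using padic_norm_eq_of_diff_less[of u "of_nat a"] a assms less by simp
  have "\<not> ?p dvd a"
  proof
    assume "?p dvd a"
    then have "int ?p ^ 1 dvd int a" by simp
    from padic_norm_of_int_dvd[OF this] na less show False by simp
  qed
  then have "[a ^ (?p - 1) = 1] (mod ?p)" using fermat_theorem[OF prime_card] by blast
  then have "[int (a ^ (?p - 1)) = int 1] (mod (int ?p))" by (simp only: cong_int_iff)
  then have "int ?p ^ 1 dvd int (a ^ (?p - 1)) - 1" by (simp add: cong_iff_dvd_diff)
  from padic_norm_of_int_dvd[OF this]
  have 1: "padic_norm (of_nat a ^ (?p - 1) - 1 :: 'p padic) \<le> 1 / ?p" by simp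
  \<comment> \<open>Factoring out \<open>u - of_nat a\<close> shows that the power of
    \<open>u\<close> is as close to the power of \<open>a\<close> as \<open>u\<close> is to
    \<open>a\<close>.\<close>
  have "u ^ (?p - 1) - of_nat a ^ (?p - 1)
      = (u - of_nat a) * (\<Sum>i<?p - 1. of_nat a ^ (?p - 1 - Suc i) * u ^ i)"
    by (simp add: power_diff_sumr2)
  moreover have "padic_norm (\<Sum>i<?p - 1. of_nat a ^ (?p - 1 - Suc i) * u ^ i) \<le> 1"
    by (intro padic_norm_sum_le) (simp_all add: padic_norm_mult padic_norm_power assms na)
  ultimately have 2: "padic_norm (u ^ (?p - 1) - of_nat a ^ (?p - 1)) \<le> 1 / ?p"
    using a mult_mono[of "padic_norm (u - of_nat a)" "1 / ?p" _ 1] by (simp add: padic_norm_mult)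
  show ?case using padic_norm_add_le[OF 2 1] by simp
next
  case (Suc k)
  let ?p = "CARD('p)" and ?w = "u ^ ((CARD('p) - 1) * CARD('p) ^ k)"
  have w: "padic_norm (?w ^ i) = 1" for i by (simp add: padic_norm_power assms)
  have "1 \<le> ?p ^ k" by (simp add: Suc_leI)
  then have "real ?p \<le> real ?p ^ Suc k" by (simp add: of_nat_power[symmetric] del: of_nat_power)
  then have le: "1 / real ?p ^ Suc k \<le> 1 / ?p" by (intro divide_left_mono) auto
  \<comment> \<open>Accuracy \<open>1 / p\<close> is enough here; the finer accuracy enters through
    the other factor \<open>?w - 1\<close>.\<close>
  have wi: "padic_norm (?w ^ i - 1) \<le> 1 / ?p" for i
  proof (induction i)
    case (Suc i)
    have "?w ^ Suc i - 1 = ?w ^ i * (?w - 1) + (?w ^ i - 1)" by (simp add: algebra_simps)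
    moreover have "padic_norm (?w ^ i * (?w - 1)) \<le> 1 / ?p"
      unfolding padic_norm_mult w using Suc.IH \<open>padic_norm (?w - 1) \<le> 1 / _\<close> le by simp
    ultimately show ?case using padic_norm_add_le[OF _ Suc.IH] by metis
  qed simp
  have "(\<Sum>i<?p. ?w ^ i) = (\<Sum>i<?p. ?w ^ i - 1) + of_nat ?p"
    by (simp add: sum_subtractf)
  moreover have "padic_norm \<dots> \<le> 1 / ?p"
    by (intro padic_norm_add_le padic_norm_sum_le wi) (simp_all add: padic_norm_p)
  ultimately have s: "padic_norm (\<Sum>i<?p. ?w ^ i) \<le> 1 / ?p" by simp
  have "u ^ ((CARD('p) - 1) * CARD('p) ^ Suc k) = ?w ^ ?p"
    by (simp add: power_mult[symmetric] mult_ac)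
  also have "?w ^ ?p - 1 = (?w - 1) * (\<Sum>i<?p. ?w ^ i)"
    by (simp add: power_diff_1_eq)
  finally have "padic_norm (u ^ ((CARD('p) - 1) * CARD('p) ^ Suc k) - 1)
      = padic_norm (?w - 1) * padic_norm (\<Sum>i<?p. ?w ^ i)"
    by (simp only: padic_norm_mult)
  also have "\<dots> \<le> 1 / real ?p ^ Suc k * (1 / ?p)"
    by (intro mult_mono Suc s) auto
  finally show ?case by (simp add: mult_ac)
qed

section \<open>Topology of the \<open>p\<close>-adic numbers\<close>

lemma padic_inverse_power_less:
  assumes "e > 0"
  obtains k where "1 / real CARD('p :: prime_card) ^ k < e"
proof -
  have "1 / real CARD('p) < 1" using prime_gt_1_nat[OF prime_card[where 'a = 'p]] by simp
  from real_arch_pow_inv[OF assms this] show ?thesis using that by (auto simp: power_divide)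
qed

text \<open>Provides \<open>tendsto_sum\<close> and \<open>tendsto_mult\<close> for the continuity
  of scalar products and character sums.\<close>

instance padic :: (prime_card) "{topological_comm_monoid_add, topological_comm_monoid_mult}"
proof
  fix a b :: "'a padic"
  let ?F = "nhds a \<times>\<^sub>F nhds b"
  have near: "\<forall>\<^sub>F z in ?F. padic_norm (fst z - a) < r \<and> padic_norm (snd z - b) < r" if "r > 0" for r
  proof -
    have "\<forall>\<^sub>F x in nhds c. padic_norm (x - c) < r" for c :: "'a padic"
      using that unfolding eventually_nhds_metric dist_padic_def by blast
    then show ?thesis by (auto simp: eventually_prod_filter)
  qed
  show "LIM z ?F. fst z + snd z :> nhds (a + b)"
    unfolding tendsto_iff
  proof (intro allI impI)
    fix e :: real assume "e > 0"
    from near[OF this] show "\<forall>\<^sub>F z in ?F. dist (fst z + snd z) (a + b) < e"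
    proof eventually_elim
      case (elim z)
      then show ?case using padic_norm_add_less[of "fst z - a" e "snd z - b"]
        by (simp add: dist_padic_def algebra_simps)
    qed
  qed
  show "LIM z ?F. fst z * snd z :> nhds (a * b)"
    unfolding tendsto_iff
  proof (intro allI impI)
    fix e :: real assume e: "e > 0"
    \<comment> \<open>\<open>B\<close> bounds \<open>padic_norm a\<close> and, within distance 1 of
      the limit, also \<open>padic_norm (snd z)\<close>. These are the cofactors in
      \<open>x * y - a * b = (x - a) * y + a * (y - b)\<close>.\<close>
    define B where "B = 1 + padic_norm a + padic_norm b"
    have B: "B \<ge> 1" by (simp add: B_def)
    define r where "r = min 1 (e / B)"
    have r: "r > 0" "r \<le> 1" "r * B \<le> e" using e B by (auto simp: r_def min_def field_simps)
    from near[OF r(1)] show "\<forall>\<^sub>F z in ?F. dist (fst z * snd z) (a * b) < e"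
    proof eventually_elim
      case (elim z)
      have "padic_norm (snd z) \<le> padic_norm (snd z - b) + padic_norm b"
        using padic_norm_triangle[of "snd z - b" b] by simp
      then have "padic_norm (snd z) \<le> B" using elim r(2) padic_norm_nonneg[of a] unfolding B_def by linarith
      then have "padic_norm (fst z - a) * padic_norm (snd z) \<le> padic_norm (fst z - a) * B"
        by (intro mult_left_mono) auto
      also have "\<dots> < r * B" using elim B by (intro mult_strict_right_mono) auto
      finally have 1: "padic_norm ((fst z - a) * snd z) < e" using r(3) by (simp add: padic_norm_mult)
      have "padic_norm a * padic_norm (snd z - b) \<le> B * padic_norm (snd z - b)"
        by (intro mult_right_mono) (auto simp: B_def)
      also have "\<dots> < B * r" using elim B by (intro mult_strict_left_mono) auto
      finally have 2: "padic_norm (a * (snd z - b)) < e" using r(3)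
        by (simp add: padic_norm_mult mult.commute)
      show ?case using padic_norm_add_less[OF 1 2] by (simp add: dist_padic_def algebra_simps)
    qed
  qed
qed

text \<open>Each \<open>X n\<close> is replaced by a rational \<open>q n\<close> at distance less
  than \<open>1 / (n + 1)\<close>. The sequence \<open>q\<close> is again Cauchy, and its class is
  the limit of \<open>X\<close>.\<close>

instance padic :: (prime_card) complete_space
proof
  fix X :: "nat \<Rightarrow> 'a padic" assume X: "Cauchy X"
  have "\<exists>q. padic_norm (X n - padic_of_rat q) < inverse (real (Suc n))" for n
    by (metis padic_of_rat_dense inverse_positive_iff_positive of_nat_0_less_iff zero_less_Suc)
  then obtain q where q: "\<And>n. padic_norm (X n - padic_of_rat (q n)) < inverse (real (Suc n))"
    by metis
  have qe: "\<exists>N. \<forall>n\<ge>N. padic_norm (X n - padic_of_rat (q n)) < e" if e: "e > 0" for e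
  proof -
    obtain N where N: "inverse (real (Suc N)) < e" using reals_Archimedean[OF e] by blast
    have "padic_norm (X n - padic_of_rat (q n)) < e" if "n \<ge> N" for n
    proof -
      have "inverse (real (Suc n)) \<le> inverse (real (Suc N))" using that by (simp add: le_imp_inverse_le)
      then show ?thesis using q[of n] N by linarith
    qed
    then show ?thesis by blast
  qed
  have cq: "padic_cauchy CARD('a) q"
    unfolding padic_cauchy_def
  proof (intro allI impI)
    fix e :: real assume e: "e > 0"
    obtain N where N: "\<And>n. n \<ge> N \<Longrightarrow> padic_norm (X n - padic_of_rat (q n)) < e" using qe[OF e] by blast
    obtain M where M: "\<And>m n. m \<ge> M \<Longrightarrow> n \<ge> M \<Longrightarrow> padic_norm (X m - X n) < e"
      using X e unfolding Cauchy_def dist_padic_def by meson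
    have "rat_padic_abs CARD('a) (q m - q n) < e" if mn: "m \<ge> max M N" "n \<ge> max M N" for m n
    proof -
      \<comment> \<open>The expression telescopes to the image of \<open>q m - q n\<close>.\<close>
      have "padic_norm (((X m - X n) - (X m - padic_of_rat (q m))) + (X n - padic_of_rat (q n))) < e"
        using mn by (intro padic_norm_add_less[OF padic_norm_diff_less[OF M N] N]) auto
      then show ?thesis by (simp add: padic_of_rat_diff flip: padic_norm_of_rat)
    qed
    then show "\<exists>k. \<forall>m\<ge>k. \<forall>n\<ge>k. rat_padic_abs CARD('a) (q m - q n) < e" by blast
  qed
  have "X \<longlonglongrightarrow> Padic q"
    unfolding lim_sequentially
  proof (intro allI impI)
    fix e :: real assume e: "e > 0"
    obtain N where N: "\<And>n. n \<ge> N \<Longrightarrow> padic_norm (X n - padic_of_rat (q n)) < e" using qe[OF e] by blast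
    obtain M where M: "\<And>m. m \<ge> M \<Longrightarrow> padic_norm (Padic q - padic_of_rat (q m) :: 'a padic) < e"
      using Padic_approx[OF cq e] by blast
    have "dist (X n) (Padic q) < e" if "n \<ge> max M N" for n
      using padic_norm_diff_less[OF N M, of n n] that by (simp add: dist_padic_def)
    then show "\<exists>no. \<forall>n\<ge>no. dist (X n) (Padic q) < e" by blast
  qed
  then show "convergent X" by (rule convergentI)
qed

text \<open>A closed ball in a complete space is complete, and the residues modulo
  \<open>p ^ k\<close> form a finite net.\<close>

lemma compact_padic_ints: "compact (padic_ints :: 'p :: prime_card padic set)"
  unfolding compact_eq_totally_bounded
proof (intro conjI allI impI)
  have "padic_ints = cball (0 :: 'p padic) 1"
    by (auto simp: padic_ints_def dist_padic_def)
  then show "complete (padic_ints :: 'p padic set)" by (metis closed_cball complete_eq_closed)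
  fix e :: real assume "e > 0"
  then obtain k where k: "1 / real CARD('p) ^ k < e" using padic_inverse_power_less by blast
  let ?P = "int CARD('p) ^ k"
  have "padic_ints \<subseteq> (\<Union>x\<in>of_int ` {0..<?P}. ball (x :: 'p padic) e)"
  proof
    fix x :: "'p padic" assume "x \<in> padic_ints"
    then obtain a :: int where a: "padic_norm (x - of_int a) \<le> 1 / real CARD('p) ^ k"
      using padic_int_approx[of x k] by (auto simp: padic_ints_def)
    have "?P dvd a - a mod ?P" by (simp add: mod_eq_dvd_iff[symmetric])
    from padic_norm_add_le[OF a padic_norm_of_int_dvd[OF this]]
    have "padic_norm (x - of_int (a mod ?P)) < e" using k by simp
    moreover have "a mod ?P \<in> {0..<?P}" by simp
    ultimately show "x \<in> (\<Union>x\<in>of_int ` {0..<?P}. ball (x :: 'p padic) e)"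
      by (auto simp: dist_padic_def padic_norm_minus_commute)
  qed
  then show "\<exists>K. finite K \<and> padic_ints \<subseteq> (\<Union>x\<in>K. ball (x :: 'p padic) e)"
    by (intro exI[of _ "of_int ` {0..<?P}"]) auto
qed

section \<open>The \<open>p\<close>-adic Stone--Weierstrass theorem\<close>

locale padic_separating_algebra =
  fixes T :: "'a topology" and A :: "('a \<Rightarrow> 'p :: prime_card padic) set"
  assumes compact: "compact_space T"
    and cont: "g \<in> A \<Longrightarrow> continuous_map T euclidean g"
    and const: "(\<lambda>_. c) \<in> A"
    and add: "g \<in> A \<Longrightarrow> h \<in> A \<Longrightarrow> (\<lambda>x. g x + h x) \<in> A"
    and mult: "g \<in> A \<Longrightarrow> h \<in> A \<Longrightarrow> (\<lambda>x. g x * h x) \<in> A"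
    and separates: "x \<in> topspace T \<Longrightarrow> y \<in> topspace T \<Longrightarrow> x \<noteq> y \<Longrightarrow> \<exists>g\<in>A. g x \<noteq> g y"
begin

text \<open>Functions are total on \<open>'a\<close>, but only their values on
  \<open>topspace T\<close> matter; see \<open>uclosure_cong\<close>.\<close>

definition uclosure :: "('a \<Rightarrow> 'p padic) set" where
  "uclosure = {g. \<forall>e>0. \<exists>h\<in>A. \<forall>x\<in>topspace T. padic_norm (g x - h x) < e}"

lemma openin_norm_less:
  assumes "continuous_map T euclidean (g :: 'a \<Rightarrow> 'p padic)"
  shows "openin T {x \<in> topspace T. padic_norm (g x - c) < r}"
  using openin_continuous_map_preimage[OF assms, of "ball c r"]
  by (simp add: dist_padic_def padic_norm_minus_commute)

text \<open>By the isosceles principle, every point within \<open>r\<close> of some \<open>c\<close>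
  of norm at least \<open>r\<close> has the norm of \<open>c\<close>, so the condition defines a
  union of preimages of open balls.\<close>

lemma openin_norm_ge:
  assumes "continuous_map T euclidean (g :: 'a \<Rightarrow> 'p padic)" "r > 0"
  shows "openin T {x \<in> topspace T. padic_norm (g x) \<ge> r}"
proof -
  have eq: "{x \<in> topspace T. padic_norm (g x) \<ge> r}
      = (\<Union>c\<in>{c. padic_norm c \<ge> r}. {x \<in> topspace T. padic_norm (g x - c) < r})"
  proof (intro equalityI subsetI)
    fix x assume "x \<in> {x \<in> topspace T. padic_norm (g x) \<ge> r}"
    then show "x \<in> (\<Union>c\<in>{c. padic_norm c \<ge> r}. {x \<in> topspace T. padic_norm (g x - c) < r})"
      using assms(2) by (intro UN_I[of "g x"]) auto
  next
    fix x assume "x \<in> (\<Union>c\<in>{c. padic_norm c \<ge> r}. {x \<in> topspace T. padic_norm (g x - c) < r})"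
    then obtain c where c: "x \<in> topspace T" "padic_norm c \<ge> r" "padic_norm (c - g x) < r"
      by (auto simp: padic_norm_minus_commute)
    then show "x \<in> {x \<in> topspace T. padic_norm (g x) \<ge> r}"
      using padic_norm_eq_of_diff_less[of c "g x"] by simp
  qed
  show ?thesis unfolding eq by (rule openin_Union) (use openin_norm_less[OF assms(1)] in blast)
qed

lemma bounded:
  assumes "g \<in> A"
  shows "\<exists>B>0. \<forall>x\<in>topspace T. padic_norm (g x) \<le> B"
proof -
  have "compactin euclidean (g ` topspace T)"
    using image_compactin[OF _ cont[OF assms]] compact by (simp add: compact_space_def)
  then have "bounded (g ` topspace T)" by (simp add: compact_imp_bounded)
  then obtain B where "\<And>x. x \<in> topspace T \<Longrightarrow> padic_norm (g x) \<le> B"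
    unfolding bounded_any_center[of _ 0] by (auto simp: dist_padic_def)
  then show ?thesis by (intro exI[of _ "max 1 B"]) fastforce
qed

section \<open>The uniform closure is a uniformly closed algebra\<close>

lemma uclosureD:
  "g \<in> uclosure \<Longrightarrow> e > 0 \<Longrightarrow> \<exists>h\<in>A. \<forall>x\<in>topspace T. padic_norm (g x - h x) < e"
  by (simp add: uclosure_def)

lemma uclosure_superset: "g \<in> A \<Longrightarrow> g \<in> uclosure"
  unfolding uclosure_def by force

lemma uclosure_cong:
  assumes "g \<in> uclosure" "\<And>x. x \<in> topspace T \<Longrightarrow> g x = h x"
  shows "h \<in> uclosure"
  using assms unfolding uclosure_def by simp

text \<open>Taking the closure twice adds nothing, so approximants may themselves come from
  \<open>uclosure\<close>. The strong triangle inequality avoids halving \<open>e\<close>.\<close>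

lemma uclosure_closed:
  assumes "\<And>e. e > 0 \<Longrightarrow> \<exists>h\<in>uclosure. \<forall>x\<in>topspace T. padic_norm (g x - h x) < e"
  shows "g \<in> uclosure"
  unfolding uclosure_def
proof safe
  fix e :: real assume e: "e > 0"
  obtain h where h: "h \<in> uclosure" "\<And>x. x \<in> topspace T \<Longrightarrow> padic_norm (g x - h x) < e"
    using assms[OF e] by blast
  obtain k where k: "k \<in> A" "\<And>x. x \<in> topspace T \<Longrightarrow> padic_norm (h x - k x) < e"
    using uclosureD[OF h(1) e] by blast
  have "padic_norm (g x - k x) < e" if "x \<in> topspace T" for x
    using padic_norm_add_less[OF h(2) k(2), OF that that] by simp
  then show "\<exists>h\<in>A. \<forall>x\<in>topspace T. padic_norm (g x - h x) < e" using k(1) by blast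
qed

lemma uclosure_const: "(\<lambda>_. c) \<in> uclosure"
  by (rule uclosure_superset[OF const])

lemma uclosure_add:
  assumes "g \<in> uclosure" "h \<in> uclosure"
  shows "(\<lambda>x. g x + h x) \<in> uclosure"
  unfolding uclosure_def
proof safe
  fix e :: real assume "e > 0"
  then obtain g' h' where g': "g' \<in> A" "\<And>x. x \<in> topspace T \<Longrightarrow> padic_norm (g x - g' x) < e"
    and h': "h' \<in> A" "\<And>x. x \<in> topspace T \<Longrightarrow> padic_norm (h x - h' x) < e"
    using uclosureD[OF assms(1)] uclosureD[OF assms(2)] by meson
  have "padic_norm (g x + h x - (g' x + h' x)) < e" if "x \<in> topspace T" for x
    using padic_norm_add_less[OF g'(2) h'(2), OF that that] by (simp add: algebra_simps)
  then show "\<exists>k\<in>A. \<forall>x\<in>topspace T. padic_norm (g x + h x - k x) < e"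
    using add[OF g'(1) h'(1)] by (intro bexI[of _ "\<lambda>x. g' x + h' x"]) auto
qed

lemma uclosure_mult:
  assumes "g \<in> uclosure" "h \<in> uclosure"
  shows "(\<lambda>x. g x * h x) \<in> uclosure"
  unfolding uclosure_def
proof safe
  fix e :: real assume e: "e > 0"
  \<comment> \<open>\<open>g\<close> is bounded because it is close to a bounded member of
    \<open>A\<close>. This bound fixes the accuracy of \<open>h'\<close>, and the bound of
    \<open>h'\<close> then fixes the accuracy of \<open>g'\<close>.\<close>
  obtain g0 where g0: "g0 \<in> A" "\<And>x. x \<in> topspace T \<Longrightarrow> padic_norm (g x - g0 x) < 1"
    using uclosureD[OF assms(1), of 1] by auto
  obtain B0 where B0: "\<And>x. x \<in> topspace T \<Longrightarrow> padic_norm (g0 x) \<le> B0"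
    using bounded[OF g0(1)] by blast
  define B where "B = max 1 B0"
  have B: "B > 0" by (simp add: B_def)
  have gB: "padic_norm (g x) \<le> B" if "x \<in> topspace T" for x
    using padic_norm_add_le[of "g x - g0 x" B "g0 x"] g0(2)[OF that] B0[OF that] by (simp add: B_def)
  obtain h' where h': "h' \<in> A" "\<And>x. x \<in> topspace T \<Longrightarrow> padic_norm (h x - h' x) < e / B"
    using uclosureD[OF assms(2) divide_pos_pos[OF e B]] by blast
  obtain C where C: "C > 0" "\<And>x. x \<in> topspace T \<Longrightarrow> padic_norm (h' x) \<le> C"
    using bounded[OF h'(1)] by blast
  obtain g' where g': "g' \<in> A" "\<And>x. x \<in> topspace T \<Longrightarrow> padic_norm (g x - g' x) < e / C"
    using uclosureD[OF assms(1) divide_pos_pos[OF e C(1)]] by blast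
  have "padic_norm (g x * h x - g' x * h' x) < e" if x: "x \<in> topspace T" for x
  proof -
    have "padic_norm (g x) * padic_norm (h x - h' x) \<le> B * padic_norm (h x - h' x)"
      using gB[OF x] by (intro mult_right_mono) auto
    also have "\<dots> < e" using h'(2)[OF x] B by (simp add: field_simps)
    finally have 1: "padic_norm (g x * (h x - h' x)) < e" by (simp add: padic_norm_mult)
    have "padic_norm (g x - g' x) * padic_norm (h' x) \<le> padic_norm (g x - g' x) * C"
      using C(2)[OF x] by (intro mult_left_mono) auto
    also have "\<dots> < e" using g'(2)[OF x] C(1) by (simp add: field_simps)
    finally have 2: "padic_norm ((g x - g' x) * h' x) < e" by (simp add: padic_norm_mult)
    show ?thesis using padic_norm_add_less[OF 1 2] by (simp add: algebra_simps)
  qed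
  then show "\<exists>k\<in>A. \<forall>x\<in>topspace T. padic_norm (g x * h x - k x) < e"
    using mult[OF g'(1) h'(1)] by (intro bexI[of _ "\<lambda>x. g' x * h' x"]) auto
qed

lemma uclosure_diff:
  assumes "g \<in> uclosure" "h \<in> uclosure"
  shows "(\<lambda>x. g x - h x) \<in> uclosure"
  using uclosure_add[OF assms(1) uclosure_mult[OF uclosure_const[of "-1"] assms(2)]] by simp

lemma uclosure_power: "g \<in> uclosure \<Longrightarrow> (\<lambda>x. g x ^ k) \<in> uclosure"
  by (induction k) (simp_all add: uclosure_const uclosure_mult)

section \<open>Indicator functions in the closure\<close>

text \<open>Where \<open>g\<close> has norm 1, \<open>padic_unit_power_near_1\<close> applies.
  Elsewhere discreteness gives norm at most \<open>1 / p\<close>, and the exponent \<open>?M\<close>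
  is at least \<open>k\<close>, so the power has norm at most \<open>1 / p ^ k\<close>.\<close>

lemma uclosure_unit_indicator:
  assumes "g \<in> uclosure" "\<And>x. x \<in> topspace T \<Longrightarrow> padic_norm (g x) \<le> 1"
  shows "(\<lambda>x. of_bool (padic_norm (g x) = 1)) \<in> uclosure"
proof (rule uclosure_closed)
  fix e :: real assume "e > 0"
  then obtain k where k: "1 / real CARD('p) ^ k < e" using padic_inverse_power_less by blast
  let ?p = "CARD('p)" and ?M = "(CARD('p) - 1) * CARD('p) ^ k"
  have p: "?p > 1" using prime_gt_1_nat[OF prime_card[where 'a = 'p]] .
  have "padic_norm (of_bool (padic_norm (g x) = 1) - g x ^ ?M) < e" if x: "x \<in> topspace T" for x
  proof (cases "padic_norm (g x) = 1")
    case True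
    have "1 / real ?p ^ Suc k \<le> 1 / real ?p ^ k"
      using p by (intro divide_left_mono) auto
    then show ?thesis
      using padic_unit_power_near_1[OF True, of k] k True by (simp add: padic_norm_minus_commute)
  next
    case False
    then have "padic_norm (g x) \<le> 1 / ?p" using assms(2)[OF x] by (intro padic_norm_less_1) simp
    then have "padic_norm (g x ^ ?M) \<le> (1 / ?p) ^ ?M"
      unfolding padic_norm_power by (intro power_mono) auto
    also have "\<dots> \<le> (1 / ?p) ^ k"
    proof (rule power_decreasing)
      have "k \<le> ?p ^ k" using power_gt_expt[of ?p k] p by simp
      also have "\<dots> \<le> ?M" using p by simp
      finally show "k \<le> ?M" .
    qed (use p in auto)
    finally show ?thesis using False k by (simp add: power_divide)
  qed
  then show "\<exists>h\<in>uclosure. \<forall>x\<in>topspace T. padic_norm (of_bool (padic_norm (g x) = 1) - h x) < e"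
    using uclosure_power[OF assms(1), of ?M] by (intro bexI[of _ "\<lambda>x. g x ^ ?M"]) auto
qed

text \<open>Each induction step removes from the ball of radius \<open>1 / p ^ k\<close> its sphere,
  which is where the rescaled function \<open>h\<close> has norm 1. By discreteness what remains is
  the next smaller ball.\<close>

lemma uclosure_ball_indicator:
  assumes "g \<in> uclosure" "\<And>x. x \<in> topspace T \<Longrightarrow> padic_norm (g x) \<le> 1"
  shows "(\<lambda>x. of_bool (padic_norm (g x) \<le> 1 / real CARD('p) ^ k)) \<in> uclosure"
proof (induction k)
  case 0
  show ?case by (rule uclosure_cong[OF uclosure_const[of 1]]) (simp add: assms(2))
next
  case (Suc k)
  let ?p = "real CARD('p)"
  \<comment> \<open>Dividing by \<open>p ^ k\<close> enlarges norms; the indicator from the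
    induction hypothesis keeps \<open>h\<close> bounded by 1.\<close>
  define h where "h x = of_bool (padic_norm (g x) \<le> 1 / ?p ^ k) * g x * inverse (of_nat CARD('p)) ^ k" for x
  have p: "?p > 1" using prime_gt_1_nat[OF prime_card[where 'a = 'p]] by simp
  have "h \<in> uclosure"
    unfolding h_def by (intro uclosure_mult Suc assms(1) uclosure_const)
  have nh: "padic_norm (h x) = (if padic_norm (g x) \<le> 1 / ?p ^ k then padic_norm (g x) * ?p ^ k else 0)" for x
    unfolding h_def by (simp add: padic_norm_mult padic_norm_power padic_norm_inverse padic_norm_p)
  have h1: "padic_norm (h x) \<le> 1" for x
    using p by (simp add: nh field_simps)
  show ?case
  proof (rule uclosure_cong[OF uclosure_diff[OF Suc uclosure_unit_indicator[OF \<open>h \<in> uclosure\<close> h1]]])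
    fix x assume "x \<in> topspace T"
    have "1 / ?p ^ Suc k < 1 / ?p ^ k" using p by (intro divide_strict_left_mono) auto
    moreover have "padic_norm (g x) \<le> 1 / ?p ^ Suc k"
      if "padic_norm (g x) \<le> 1 / ?p ^ k" "padic_norm (h x) \<noteq> 1"
    proof -
      have "padic_norm (h x) \<le> 1 / ?p" using h1[of x] that by (intro padic_norm_less_1) simp
      then show ?thesis using that p by (simp add: nh field_simps)
    qed
    moreover have "padic_norm (h x) = 1 \<longleftrightarrow> padic_norm (g x) = 1 / ?p ^ k"
      using p by (auto simp: nh field_simps)
    ultimately show "of_bool (padic_norm (g x) \<le> 1 / ?p ^ k) - of_bool (padic_norm (h x) = 1)
        = (of_bool (padic_norm (g x) \<le> 1 / ?p ^ Suc k) :: 'p padic)"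
      by auto
  qed
qed

text \<open>A separating function is translated to vanish at \<open>x\<close> and scaled by a power
  of p into the unit ball; \<open>V\<close> is the preimage of a ball about 0 too small to contain
  the value at \<open>y\<close>. Ultrametric balls of positive radius are clopen, and openness of
  the complement feeds the covering argument that follows.\<close>

lemma uclosure_separating_indicator:
  assumes "x \<in> topspace T" "y \<in> topspace T" "x \<noteq> y"
  shows "\<exists>V. openin T V \<and> openin T (topspace T - V) \<and> x \<in> V \<and> y \<notin> V
    \<and> (\<lambda>z. of_bool (z \<in> V)) \<in> uclosure"
proof -
  obtain g0 where g0: "g0 \<in> A" "g0 x \<noteq> g0 y" using separates[OF assms] by blast
  define g1 where "g1 z = g0 z + (- g0 x)" for z
  have g1: "g1 \<in> A" unfolding g1_def by (intro add g0 const)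
  obtain B where B: "B > 0" "\<And>z. z \<in> topspace T \<Longrightarrow> padic_norm (g1 z) \<le> B" using bounded[OF g1] by blast
  obtain j where j: "1 / real CARD('p) ^ j < 1 / B" using padic_inverse_power_less[of "1 / B"] B by auto
  define g where "g z = of_nat CARD('p) ^ j * g1 z" for z
  have g: "g \<in> A" unfolding g_def by (intro mult const g1)
  have g_le: "padic_norm (g z) \<le> 1" if "z \<in> topspace T" for z
  proof -
    have "padic_norm (g z) = 1 / real CARD('p) ^ j * padic_norm (g1 z)"
      by (simp add: g_def padic_norm_mult padic_norm_power padic_norm_p power_divide)
    also have "\<dots> \<le> 1 / B * B" using j B that by (intro mult_mono) auto
    finally show ?thesis using B by simp
  qed
  have "of_nat CARD('p) \<noteq> (0 :: 'p padic)" using padic_norm_p[where 'p = 'p] by auto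
  then have "g x = 0" "g y \<noteq> 0" using g0(2) by (auto simp: g_def g1_def)
  then obtain k where k: "1 / real CARD('p) ^ k < padic_norm (g y)"
    using padic_inverse_power_less padic_norm_pos by blast
  define V where "V = {z \<in> topspace T. padic_norm (g z) \<le> 1 / real CARD('p) ^ k}"
  let ?r = "1 / real CARD('p) ^ k"
  have "(\<lambda>z. of_bool (z \<in> V)) \<in> uclosure"
    by (rule uclosure_cong[OF uclosure_ball_indicator[OF uclosure_superset[OF g] g_le, of k]])
      (simp_all add: V_def)
  moreover have "openin T V"
  proof (rule openin_subopen[THEN iffD2], intro ballI)
    fix z assume z: "z \<in> V"
    have "{w \<in> topspace T. padic_norm (g w - g z) < ?r} \<subseteq> V"
    proof
      fix w assume "w \<in> {w \<in> topspace T. padic_norm (g w - g z) < ?r}"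
      then show "w \<in> V" using padic_norm_add_le[of "g w - g z" ?r "g z"] z by (simp add: V_def)
    qed
    then show "\<exists>U. openin T U \<and> z \<in> U \<and> U \<subseteq> V"
      using z openin_norm_less[OF cont[OF g], of "g z" ?r]
      by (intro exI[of _ "{w \<in> topspace T. padic_norm (g w - g z) < ?r}"]) (simp add: V_def)
  qed
  moreover have "openin T (topspace T - V)"
  proof (rule openin_subopen[THEN iffD2], intro ballI)
    fix z assume z: "z \<in> topspace T - V"
    then have "\<not> padic_norm (g z) \<le> ?r" unfolding V_def by blast
    then have "padic_norm (g z) > ?r" by (rule not_le_imp_less)
    moreover from this have "padic_norm (g z) > 0"
      by (rule le_less_trans[rotated]) simp
    ultimately show "\<exists>U. openin T U \<and> z \<in> U \<and> U \<subseteq> topspace T - V"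
      using z openin_norm_ge[OF cont[OF g], of "padic_norm (g z)"]
      by (intro exI[of _ "{w \<in> topspace T. padic_norm (g w) \<ge> padic_norm (g z)}"]) (auto simp: V_def)
  qed
  ultimately show ?thesis
    using assms(1) k \<open>g x = 0\<close> by (intro exI[of _ V]) (simp add: V_def)
qed

text \<open>For each \<open>y\<close> outside \<open>U\<close> there is a clopen set around
  \<open>x\<close> missing \<open>y\<close>. Finitely many of the complements cover the compact
  complement of \<open>U\<close>, so the corresponding finite intersection lies in \<open>U\<close>;
  its indicator is a product of indicators.\<close>

lemma uclosure_neighbourhood_indicator:
  assumes "openin T U" "x \<in> U"
  shows "\<exists>V. openin T V \<and> x \<in> V \<and> V \<subseteq> U \<and> (\<lambda>z. of_bool (z \<in> V)) \<in> uclosure"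
proof -
  let ?good = "\<lambda>V. openin T V \<and> x \<in> V \<and> (\<lambda>z. of_bool (z \<in> V) :: 'p padic) \<in> uclosure"
  have x: "x \<in> topspace T" using assms openin_subset by blast
  have "\<forall>y\<in>topspace T - U. \<exists>V. ?good V \<and> y \<notin> V \<and> openin T (topspace T - V)"
  proof
    fix y assume "y \<in> topspace T - U"
    then show "\<exists>V. ?good V \<and> y \<notin> V \<and> openin T (topspace T - V)"
      using uclosure_separating_indicator[of x y] x assms(2) by blast
  qed
  from bchoice[OF this] obtain V
    where V: "\<And>y. y \<in> topspace T - U \<Longrightarrow> ?good (V y) \<and> y \<notin> V y \<and> openin T (topspace T - V y)"
    by blast
  have "compactin T (topspace T - U)"
    using compact assms(1) by (metis closedin_compact_space openin_closedin_eq)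
  moreover have "\<forall>W\<in>(\<lambda>y. topspace T - V y) ` (topspace T - U). openin T W" using V by blast
  moreover have "topspace T - U \<subseteq> \<Union> ((\<lambda>y. topspace T - V y) ` (topspace T - U))" using V by blast
  ultimately obtain G where G: "finite G" "G \<subseteq> (\<lambda>y. topspace T - V y) ` (topspace T - U)"
    "topspace T - U \<subseteq> \<Union> G"
    unfolding compactin_def by meson
  obtain F where F: "F \<subseteq> topspace T - U" "finite F" "G = (\<lambda>y. topspace T - V y) ` F"
    using finite_subset_image[OF G(1,2)] by blast
  \<comment> \<open>Meeting with \<open>topspace T\<close> keeps the empty intersection, which
    occurs if \<open>U\<close> is the whole space, an open set of \<open>T\<close>.\<close>
  have "?good (topspace T \<inter> (\<Inter>y\<in>F. V y))"
    using F(2,1)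
  proof (induction F)
    case empty
    show ?case
      using x uclosure_cong[OF uclosure_const[of 1], of "\<lambda>z. of_bool (z \<in> topspace T)"] by simp
  next
    case (insert y F)
    let ?W = "topspace T \<inter> (\<Inter>y\<in>F. V y)"
    have y: "?good (V y)" and F: "?good ?W" using insert V by auto
    have "(\<lambda>z. of_bool (z \<in> V y \<inter> ?W)) = (\<lambda>z. of_bool (z \<in> V y) * (of_bool (z \<in> ?W) :: 'p padic))"
      by auto
    then have "(\<lambda>z. of_bool (z \<in> V y \<inter> ?W) :: 'p padic) \<in> uclosure"
      using y F uclosure_mult by simp
    then have "?good (V y \<inter> ?W)" using y F by blast
    moreover have "V y \<inter> ?W = topspace T \<inter> (\<Inter>y\<in>insert y F. V y)" by auto
    ultimately show ?case by simp
  qed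
  moreover have "topspace T \<inter> (\<Inter>y\<in>F. V y) \<subseteq> U" using G(3) F(3) by blast
  ultimately show ?thesis by blast
qed

text \<open>Finitely many sets \<open>V x\<close> on which \<open>f\<close> stays within
  \<open>e\<close> of \<open>f x\<close> cover the space. A step function is assembled from their
  indicators one set at a time.\<close>

theorem stone_weierstrass:
  assumes f: "continuous_map T euclidean f" and e: "e > 0"
  shows "\<exists>h\<in>A. \<forall>x\<in>topspace T. padic_norm (f x - h x) < e"
proof -
  have "f \<in> uclosure"
  proof (rule uclosure_closed)
    fix e :: real assume e: "e > 0"
    have "\<forall>x\<in>topspace T. \<exists>V. openin T V \<and> x \<in> V \<and> V \<subseteq> {y \<in> topspace T. padic_norm (f y - f x) < e}
        \<and> (\<lambda>z. of_bool (z \<in> V) :: 'p padic) \<in> uclosure"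
    proof
      fix x assume "x \<in> topspace T"
      then have "x \<in> {y \<in> topspace T. padic_norm (f y - f x) < e}" using e by simp
      from uclosure_neighbourhood_indicator[OF openin_norm_less[OF f] this]
      show "\<exists>V. openin T V \<and> x \<in> V \<and> V \<subseteq> {y \<in> topspace T. padic_norm (f y - f x) < e}
        \<and> (\<lambda>z. of_bool (z \<in> V) :: 'p padic) \<in> uclosure" .
    qed
    from bchoice[OF this] obtain V where V: "\<And>x. x \<in> topspace T \<Longrightarrow> openin T (V x) \<and> x \<in> V x
        \<and> V x \<subseteq> {y \<in> topspace T. padic_norm (f y - f x) < e}
        \<and> (\<lambda>z. of_bool (z \<in> V x) :: 'p padic) \<in> uclosure"
      by blast
    have "\<forall>W\<in>V ` topspace T. openin T W" "topspace T \<subseteq> \<Union> (V ` topspace T)" using V by blast+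
    then obtain G where G: "finite G" "G \<subseteq> V ` topspace T" "topspace T \<subseteq> \<Union> G"
      using compact unfolding compact_space_alt by meson
    obtain F where F: "F \<subseteq> topspace T" "finite F" "G = V ` F"
      using finite_subset_image[OF G(1,2)] by blast
    have "\<exists>h\<in>uclosure. \<forall>y\<in>(\<Union>x\<in>F. V x). padic_norm (f y - h y) < e"
      using F(2,1)
    proof (induction F)
      case empty
      then show ?case using uclosure_const by blast
    next
      case (insert x F)
      then obtain h where h: "h \<in> uclosure" "\<And>y. y \<in> (\<Union>x\<in>F. V x) \<Longrightarrow> padic_norm (f y - h y) < e"
        by auto
      let ?ind = "\<lambda>z. of_bool (z \<in> V x) :: 'p padic"
      have Vx: "?ind \<in> uclosure" "\<And>y. y \<in> V x \<Longrightarrow> padic_norm (f y - f x) < e"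
        using V[of x] insert.prems by auto
      \<comment> \<open>Equal to \<open>f x\<close> on \<open>V x\<close> and to the earlier
        approximation \<open>h\<close> elsewhere: the newest set overrides, which deals with
        overlaps.\<close>
      have "(\<lambda>y. ?ind y * f x + (1 - ?ind y) * h y) \<in> uclosure"
        by (intro uclosure_add uclosure_mult uclosure_diff uclosure_const Vx h)
      moreover have "\<forall>y\<in>(\<Union>x\<in>insert x F. V x). padic_norm (f y - (?ind y * f x + (1 - ?ind y) * h y)) < e"
        using Vx(2) h(2) by auto
      ultimately show ?case
        by (intro bexI[of _ "\<lambda>y. ?ind y * f x + (1 - ?ind y) * h y"])
    qed
    then show "\<exists>h\<in>uclosure. \<forall>y\<in>topspace T. padic_norm (f y - h y) < e" using G(3) F(3) by blast
  qed
  then show ?thesis by (rule uclosureD[OF _ e])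
qed

end

section \<open>Spaces of vectors\<close>

lemma vecs_over_iff: "x \<in> vecs_over n S \<longleftrightarrow> dim_vec x = n \<and> (\<forall>i<n. x $ i \<in> S)"
  by (auto simp: vecs_over_def vec_set_def image_subset_iff)

lemma topspace_vec_topology [simp]: "topspace (vec_topology n S) = vecs_over n S"
proof -
  have "(\<lambda>x. restrict (vec_index x) {..<n}) x \<in> (\<Pi>\<^sub>E i\<in>{..<n}. S)" if "x \<in> vecs_over n S" for x
    using that by (auto simp: vecs_over_iff)
  then show ?thesis
    unfolding vec_topology_def topspace_pullback_topology topspace_product_topology by auto
qed

lemma continuous_map_vec_index:
  assumes "k < n"
  shows "continuous_map (vec_topology n S) (top_of_set S) (\<lambda>x. x $ k)"
proof -
  have "continuous_map (vec_topology n S) (top_of_set S) ((\<lambda>z. z k) \<circ> (\<lambda>x. restrict (vec_index x) {..<n}))"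
    unfolding vec_topology_def
    by (intro continuous_map_pullback continuous_map_product_projection) (use assms in simp)
  then show ?thesis using assms by (simp add: o_def)
qed

text \<open>By Tychonoff's theorem the product is compact, and \<open>vec n\<close> maps it
  continuously onto the space of vectors.\<close>

lemma compact_space_vec_topology:
  assumes "compact S"
  shows "compact_space (vec_topology n S)"
proof -
  let ?P = "product_topology (\<lambda>_. top_of_set S) {..<n}"
  have "compact_space ?P"
    using assms by (simp add: compact_space_product_topology compact_space_subtopology)
  moreover have "continuous_map ?P (vec_topology n S) (vec n)"
    unfolding vec_topology_def
  proof (rule continuous_map_pullback')
    have "continuous_map ?P ?P (\<lambda>z. z)" by simp
    then show "continuous_map ?P ?P ((\<lambda>x. restrict (vec_index x) {..<n}) \<circ> vec n)"
      by (rule continuous_map_eq) (auto simp: PiE_def extensional_def fun_eq_iff)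
    show "topspace ?P \<subseteq> vec n -` vecs_over n S"
      by (auto simp: vecs_over_iff PiE_def)
  qed
  moreover have "vec n ` topspace ?P = vecs_over n S"
  proof (intro equalityI subsetI)
    fix x assume "x \<in> vecs_over n S"
    then show "x \<in> vec n ` topspace ?P"
      by (intro image_eqI[of _ _ "restrict (vec_index x) {..<n}"]) (auto simp: vecs_over_iff)
  qed (auto simp: vecs_over_iff PiE_def)
  ultimately show ?thesis
    by (metis compact_space_def image_compactin topspace_vec_topology)
qed

lemma padic_ints_add: "x \<in> padic_ints \<Longrightarrow> y \<in> padic_ints \<Longrightarrow> x + y \<in> padic_ints"
  by (simp add: padic_ints_def padic_norm_add_le)

lemma scalar_prod_padic_ints:
  assumes "a \<in> vecs_over n padic_ints" "x \<in> vecs_over n padic_ints"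
  shows "a \<bullet> x \<in> (padic_ints :: 'p :: prime_card padic set)"
  using assms unfolding scalar_prod_def vecs_over_iff padic_ints_def
  by (auto intro!: padic_norm_sum_le mult_le_one simp: padic_norm_mult)

lemma continuous_map_scalar_prod:
  fixes a :: "'p :: prime_card padic vec"
  assumes "a \<in> vecs_over n padic_ints"
  shows "continuous_map (vec_topology n padic_ints) (top_of_set padic_ints) (\<lambda>x. a \<bullet> x)"
  unfolding continuous_map_in_subtopology
proof
  let ?T = "vec_topology n (padic_ints :: 'p padic set)"
  have "continuous_map ?T euclidean (\<lambda>x. \<Sum>i<n. a $ i * x $ i)"
    \<comment> \<open>Continuity becomes convergence along \<open>atin ?T x\<close>, to which the
      \<open>tendsto\<close> rules apply although \<open>?T\<close> is not a type class
      topology.\<close>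
    unfolding continuous_map_atin limitin_canonical_iff
  proof (intro ballI tendsto_sum tendsto_mult tendsto_const)
    fix x i assume "x \<in> topspace ?T" "i \<in> {..<n}"
    then show "((\<lambda>x. x $ i) \<longlongrightarrow> x $ i) (atin ?T x)"
      using continuous_map_into_fulltopology[OF continuous_map_vec_index[of i n padic_ints]]
      unfolding continuous_map_atin by (metis lessThan_iff limitin_canonical_iff)
  qed
  then show "continuous_map ?T euclidean (\<lambda>x. a \<bullet> x)"
    by (rule continuous_map_eq) (simp add: scalar_prod_def vecs_over_iff atLeast0LessThan)
  show "(\<bullet>) a \<in> topspace ?T \<rightarrow> padic_ints"
    using scalar_prod_padic_ints[OF assms] by auto
qed

section \<open>The algebra generated by an injective character\<close>

text \<open>The span of the functions \<open>chi (a \<bullet> x)\<close>. The vectors in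
  \<open>S\<close> later become rows of the matrix \<open>A\<close> and the coefficients
  \<open>c\<close> entries of \<open>C\<close>.\<close>

definition character_sums ::
    "('p padic \<Rightarrow> 'p padic) \<Rightarrow> nat \<Rightarrow> ('p padic vec \<Rightarrow> 'p :: prime_card padic) set" where
  "character_sums chi n = {g. \<exists>S c. finite S \<and> S \<subseteq> vecs_over n padic_ints \<and>
     (\<forall>x\<in>vecs_over n padic_ints. g x = (\<Sum>a\<in>S. c a * chi (a \<bullet> x)))}"

lemma character_sums_cong:
  assumes "g \<in> character_sums chi n" "\<And>x. x \<in> vecs_over n padic_ints \<Longrightarrow> g x = h x"
  shows "h \<in> character_sums chi n"
  using assms unfolding character_sums_def by simp

lemma character_sums_monomial:
  assumes "a \<in> vecs_over n padic_ints"
  shows "(\<lambda>x. c * chi (a \<bullet> x)) \<in> character_sums chi n"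
  unfolding character_sums_def using assms
  by (intro CollectI exI[of _ "{a}"] exI[of _ "\<lambda>_. c"]) simp

text \<open>Both coefficient families are extended by 0 to the union of the index sets.\<close>

lemma character_sums_add:
  assumes "g \<in> character_sums chi n" "h \<in> character_sums chi n"
  shows "(\<lambda>x. g x + h x) \<in> character_sums chi n"
proof -
  obtain S c where S: "finite S" "S \<subseteq> vecs_over n padic_ints"
    "\<And>x. x \<in> vecs_over n padic_ints \<Longrightarrow> g x = (\<Sum>a\<in>S. c a * chi (a \<bullet> x))"
    using assms(1) unfolding character_sums_def by blast
  obtain R d where R: "finite R" "R \<subseteq> vecs_over n padic_ints"
    "\<And>x. x \<in> vecs_over n padic_ints \<Longrightarrow> h x = (\<Sum>a\<in>R. d a * chi (a \<bullet> x))"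
    using assms(2) unfolding character_sums_def by blast
  define b where "b a = (if a \<in> S then c a else 0) + (if a \<in> R then d a else 0)" for a
  have "g x + h x = (\<Sum>a\<in>S \<union> R. b a * chi (a \<bullet> x))" if "x \<in> vecs_over n padic_ints" for x
  proof -
    have "g x = (\<Sum>a\<in>S \<union> R. (if a \<in> S then c a else 0) * chi (a \<bullet> x))"
      unfolding S(3)[OF that] using S(1) R(1) by (intro sum.mono_neutral_cong_left) auto
    moreover have "h x = (\<Sum>a\<in>S \<union> R. (if a \<in> R then d a else 0) * chi (a \<bullet> x))"
      unfolding R(3)[OF that] using S(1) R(1) by (intro sum.mono_neutral_cong_left) auto
    ultimately show ?thesis by (simp add: b_def distrib_right sum.distrib)
  qed
  then show ?thesis
    unfolding character_sums_def using S(1,2) R(1,2)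
    by (intro CollectI exI[of _ "S \<union> R"] exI[of _ b]) auto
qed

lemma character_sums_sum:
  assumes "finite I" "\<And>i. i \<in> I \<Longrightarrow> g i \<in> character_sums chi n"
  shows "(\<lambda>x. \<Sum>i\<in>I. g i x) \<in> character_sums chi n"
  using assms
proof (induction I)
  case empty
  show ?case unfolding character_sums_def by (auto intro!: exI[of _ "{}"])
qed (simp add: character_sums_add)

locale injective_padic_character =
  fixes chi :: "'p :: prime_card padic \<Rightarrow> 'p padic"
  assumes character: "padic_character padic_ints_group (top_of_set padic_ints) chi"
    and inj: "inj_on chi padic_ints"
begin

lemma chi_add: "x \<in> padic_ints \<Longrightarrow> y \<in> padic_ints \<Longrightarrow> chi (x + y) = chi x * chi y"
  using character
  by (simp add: padic_character_def hom_def padic_ints_group_def padic_units_group_def)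

lemma chi_0: "chi 0 = 1"
proof -
  have 0: "0 \<in> padic_ints" by (simp add: padic_ints_def)
  then have "chi 0 \<noteq> 0" using character
    by (auto simp: padic_character_def hom_def padic_ints_group_def padic_units_group_def)
  then show ?thesis using chi_add[OF 0 0] by simp
qed

lemma character_sums_const: "(\<lambda>_. c) \<in> character_sums chi n"
proof (rule character_sums_cong[OF character_sums_monomial[of "0\<^sub>v n" n c chi]])
  show "0\<^sub>v n \<in> vecs_over n (padic_ints :: 'p padic set)"
    by (simp add: vecs_over_iff padic_ints_def)
next
  fix x :: "'p padic vec" assume "x \<in> vecs_over n padic_ints"
  then show "c * chi (0\<^sub>v n \<bullet> x) = c" by (simp add: chi_0 scalar_prod_def vecs_over_iff)
qed

lemma character_sums_mult:
  assumes "g \<in> character_sums chi n" "h \<in> character_sums chi n"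
  shows "(\<lambda>x. g x * h x) \<in> character_sums chi n"
proof -
  obtain S c where S: "finite S" "S \<subseteq> vecs_over n padic_ints"
    "\<And>x. x \<in> vecs_over n padic_ints \<Longrightarrow> g x = (\<Sum>a\<in>S. c a * chi (a \<bullet> x))"
    using assms(1) unfolding character_sums_def by blast
  obtain R d where R: "finite R" "R \<subseteq> vecs_over n padic_ints"
    "\<And>x. x \<in> vecs_over n padic_ints \<Longrightarrow> h x = (\<Sum>a\<in>R. d a * chi (a \<bullet> x))"
    using assms(2) unfolding character_sums_def by blast
  have add: "a + b \<in> vecs_over n (padic_ints :: 'p padic set)" if "a \<in> S" "b \<in> R" for a b
    using that S(2) R(2) by (auto simp: vecs_over_iff subset_iff intro!: padic_ints_add)
  show ?thesis
  proof (rule character_sums_cong)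
    \<comment> \<open>Different pairs may have the same sum \<open>a + b\<close>; building the
      double sum from monomials with \<open>character_sums_sum\<close> avoids collecting
      coefficients.\<close>
    show "(\<lambda>x. \<Sum>a\<in>S. \<Sum>b\<in>R. c a * d b * chi ((a + b) \<bullet> x)) \<in> character_sums chi n"
      using S(1) R(1) by (intro character_sums_sum character_sums_monomial add)
  next
    fix x :: "'p padic vec" assume x: "x \<in> vecs_over n padic_ints"
    have "chi ((a + b) \<bullet> x) = chi (a \<bullet> x) * chi (b \<bullet> x)" if "a \<in> S" "b \<in> R" for a b
    proof -
      have ab: "a \<in> vecs_over n padic_ints" "b \<in> vecs_over n padic_ints" using S(2) R(2) that by auto
      then have "(a + b) \<bullet> x = a \<bullet> x + b \<bullet> x"
        using x by (intro add_scalar_prod_distrib[of _ n]) (auto simp: vecs_over_def)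
      then show ?thesis using chi_add scalar_prod_padic_ints ab x by metis
    qed
    then show "(\<Sum>a\<in>S. \<Sum>b\<in>R. c a * d b * chi ((a + b) \<bullet> x)) = g x * h x"
      unfolding S(3)[OF x] R(3)[OF x] sum_product by (intro sum.cong) simp_all
  qed
qed

lemma continuous_map_character_sums:
  assumes "g \<in> character_sums chi n"
  shows "continuous_map (vec_topology n padic_ints) euclidean g"
proof -
  let ?T = "vec_topology n (padic_ints :: 'p padic set)"
  obtain S c where S: "finite S" "S \<subseteq> vecs_over n padic_ints"
    "\<And>x. x \<in> vecs_over n padic_ints \<Longrightarrow> g x = (\<Sum>a\<in>S. c a * chi (a \<bullet> x))"
    using assms(1) unfolding character_sums_def by blast
  have "continuous_map (top_of_set padic_ints) euclidean chi"
    using character continuous_map_into_fulltopology unfolding padic_character_def by blast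
  then have chi: "continuous_map ?T euclidean (\<lambda>x. chi (a \<bullet> x))" if "a \<in> S" for a
    using continuous_map_compose[OF continuous_map_scalar_prod] S(2) that unfolding o_def by blast
  have "continuous_map ?T euclidean (\<lambda>x. \<Sum>a\<in>S. c a * chi (a \<bullet> x))"
    unfolding continuous_map_atin limitin_canonical_iff
    using chi unfolding continuous_map_atin limitin_canonical_iff
    by (intro ballI tendsto_sum tendsto_mult tendsto_const) auto
  then show ?thesis by (rule continuous_map_eq) (simp add: S(3))
qed

sublocale padic_separating_algebra "vec_topology n padic_ints" "character_sums chi n" for n
proof
  show "compact_space (vec_topology n (padic_ints :: 'p padic set))"
    by (rule compact_space_vec_topology[OF compact_padic_ints])
  fix x y :: "'p padic vec"
  assume xy: "x \<in> topspace (vec_topology n padic_ints)" "y \<in> topspace (vec_topology n padic_ints)" "x \<noteq> y"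
  then obtain k where k: "k < n" "x $ k \<noteq> y $ k" by (auto simp: vecs_over_iff vec_eq_iff)
  then have "chi (x $ k) \<noteq> chi (y $ k)"
    using xy inj by (auto simp: vecs_over_iff inj_on_def)
  \<comment> \<open>The scalar product with \<open>unit_vec n k\<close> reads off a coordinate in
    which \<open>x\<close> and \<open>y\<close> differ, and \<open>chi\<close> is injective on
    it.\<close>
  moreover have "unit_vec n k \<in> vecs_over n (padic_ints :: 'p padic set)"
    by (auto simp: vecs_over_iff padic_ints_def unit_vec_def)
  then have "(\<lambda>x. 1 * chi (unit_vec n k \<bullet> x)) \<in> character_sums chi n"
    by (rule character_sums_monomial)
  ultimately show "\<exists>g\<in>character_sums chi n. g x \<noteq> g y"
    using xy k(1) by (intro bexI) (auto simp: vecs_over_def)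
qed (simp_all add: continuous_map_character_sums character_sums_const character_sums_add
      character_sums_mult)

end

text \<open>Each coordinate of \<open>f\<close> is approximated separately by a character sum. The
  vectors occurring in these sums are listed together as the rows of \<open>A\<close>, and row
  \<open>j\<close> of \<open>C\<close> holds the coefficients for coordinate
  \<open>j\<close>.\<close>

theorem theorem4p1:
  fixes N :: "'p :: prime_card padic \<Rightarrow> real"
    and chi :: "'p padic \<Rightarrow> 'p padic"
    and n m :: nat
    and f :: "'p padic vec \<Rightarrow> 'p padic vec"
    and \<epsilon> :: real
  assumes "padic_absolute_value N"
    and "padic_character padic_ints_group (top_of_set padic_ints) chi"
    and "inj_on chi padic_ints"
    and "continuous_map (vec_topology n padic_ints) (vec_topology m UNIV) f"
    and "\<epsilon> > 0"
  shows "\<exists>d A b C.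
           A \<in> mats_over d n padic_ints \<and> b \<in> vecs_over d padic_ints \<and> C \<in> carrier_mat m d \<and>
           (\<forall>x \<in> vecs_over n padic_ints.
              linf_norm N (f x - C *\<^sub>v map_vec chi (A *\<^sub>v x + b)) < \<epsilon>)"
proof -
  interpret injective_padic_character chi
    using assms(2,3) by unfold_locales
  let ?X = "vecs_over n (padic_ints :: 'p padic set)"
  obtain s where s: "s > 0" "\<And>x. N x = padic_norm x powr s"
    using assms(1) unfolding padic_absolute_value_def by blast
  \<comment> \<open>Chosen so that \<open>\<delta> powr s = \<epsilon>\<close>, which reduces the
    claim to the normalised norm.\<close>
  define \<delta> where "\<delta> = \<epsilon> powr (1 / s)"
  have \<delta>: "\<delta> > 0" using assms(5) by (simp add: \<delta>_def)
  have N_less: "N x < \<epsilon>" if "padic_norm x < \<delta>" for x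
  proof -
    have "padic_norm x powr s < \<delta> powr s" using that s(1) by (intro powr_less_mono2) auto
    then show ?thesis using s assms(5) by (simp add: \<delta>_def powr_powr)
  qed
  have dim_f: "dim_vec (f x) = m" if "x \<in> ?X" for x
    using continuous_map_image_subset_topspace[OF assms(4)] that by (auto simp: vecs_over_iff image_subset_iff)
  have "\<exists>g\<in>character_sums chi n. \<forall>x\<in>?X. padic_norm (f x $ j - g x) < \<delta>" if "j < m" for j
  proof -
    have "continuous_map (vec_topology n padic_ints) euclidean (\<lambda>x. f x $ j)"
      using continuous_map_compose[OF assms(4) continuous_map_vec_index[OF that]] by (simp add: o_def)
    from stone_weierstrass[OF this \<delta>] show ?thesis by simp
  qed
  \<comment> \<open>The bound on \<open>j\<close> moves under the existential quantifier so that
    \<open>choice\<close> gives a total family.\<close>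
  then have "\<forall>j. \<exists>g. j < m \<longrightarrow> g \<in> character_sums chi n \<and> (\<forall>x\<in>?X. padic_norm (f x $ j - g x) < \<delta>)"
    by blast
  from choice[OF this] obtain g where g: "\<And>j. j < m \<Longrightarrow> g j \<in> character_sums chi n"
    "\<And>j x. j < m \<Longrightarrow> x \<in> ?X \<Longrightarrow> padic_norm (f x $ j - g j x) < \<delta>"
    by blast
  have "\<forall>j. \<exists>S c. j < m \<longrightarrow> finite S \<and> S \<subseteq> ?X \<and> (\<forall>x\<in>?X. g j x = (\<Sum>a\<in>S. c a * chi (a \<bullet> x)))"
    using g(1) unfolding character_sums_def mem_Collect_eq by meson
  then obtain S c where "\<forall>j. j < m \<longrightarrow> finite (S j) \<and> S j \<subseteq> ?X
      \<and> (\<forall>x\<in>?X. g j x = (\<Sum>a\<in>S j. c j a * chi (a \<bullet> x)))"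
    by metis
  then have S: "\<And>j. j < m \<Longrightarrow> finite (S j)" "\<And>j. j < m \<Longrightarrow> S j \<subseteq> ?X"
    "\<And>j x. j < m \<Longrightarrow> x \<in> ?X \<Longrightarrow> g j x = (\<Sum>a\<in>S j. c j a * chi (a \<bullet> x))"
    by blast+
  have "finite (\<Union>j<m. S j)" using S(1) by simp
  then obtain as where as: "set as = (\<Union>j<m. S j)" "distinct as"
    using finite_distinct_list by blast
  define d where "d = length as"
  have as_X: "as ! i \<in> ?X" if "i < d" for i
    using that nth_mem[of i as] S(2) by (fastforce simp: as(1) d_def)
  define A where "A = mat_of_rows n as"
  \<comment> \<open>The entry 0 switches off the vectors that belong only to other
    coordinates.\<close>
  define C where "C = mat m d (\<lambda>(j, i). if as ! i \<in> S j then c j (as ! i) else 0)"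
  have "linf_norm N (f x - C *\<^sub>v map_vec chi (A *\<^sub>v x + 0\<^sub>v d)) < \<epsilon>" if x: "x \<in> ?X" for x
  proof -
    let ?y = "f x - C *\<^sub>v map_vec chi (A *\<^sub>v x + 0\<^sub>v d)"
    have Ax: "map_vec chi (A *\<^sub>v x + 0\<^sub>v d) $ i = chi (as ! i \<bullet> x)" if "i < d" for i
      using that as_X[OF that] by (simp add: A_def d_def vecs_over_def)
    \<comment> \<open>A difference of vectors takes its dimension from the second one.\<close>
    have dim: "dim_vec ?y = m" by (simp add: C_def)
    have "?y $ j = f x $ j - g j x" if j: "j < m" for j
    proof -
      have "(C *\<^sub>v map_vec chi (A *\<^sub>v x + 0\<^sub>v d)) $ j
          = (\<Sum>i<d. (if as ! i \<in> S j then c j (as ! i) else 0) * chi (as ! i \<bullet> x))"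
        using j Ax by (simp add: C_def A_def d_def scalar_prod_def atLeast0LessThan)
      also have "\<dots> = (\<Sum>a\<in>set as. (if a \<in> S j then c j a else 0) * chi (a \<bullet> x))"
        unfolding d_def
        \<comment> \<open>Distinctness of \<open>as\<close> ensures that each vector is counted
          once.\<close>
        by (rule sum.reindex_bij_betw[OF bij_betw_nth[OF as(2) refl refl]])
      also have "\<dots> = (\<Sum>a\<in>S j. c j a * chi (a \<bullet> x))"
        using j as(1) S(1) by (intro sum.mono_neutral_cong_right) auto
      finally show ?thesis using j S(3)[OF j x] by (simp add: C_def)
    qed
    then have "N (?y $ j) < \<epsilon>" if "j < m" for j
      using N_less g(2)[OF that x] that by simp
    then show ?thesis
      \<comment> \<open>The maximum also ranges over the inserted 0, which lies below
        \<open>\<epsilon>\<close> by positivity; this is the whole content for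
        \<open>m = 0\<close>.\<close>
      using dim assms(5) by (auto simp: linf_norm_def vec_set_def)
  qed
  moreover have "A \<in> mats_over d n padic_ints"
    using as_X by (fastforce simp: mats_over_def A_def d_def elements_mat_def vecs_over_iff mat_of_rows_def)
  moreover have "0\<^sub>v d \<in> vecs_over d (padic_ints :: 'p padic set)"
    by (simp add: vecs_over_iff padic_ints_def)
  moreover have "C \<in> carrier_mat m d" by (simp add: C_def)
  ultimately show ?thesis
    by (intro exI[of _ d] exI[of _ A] exI[of _ "0\<^sub>v d"] exI[of _ C]) simp
qed

end
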